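(* Let $K>0$, $\theta>0$, $0<\beta\le 1$, $0<\gamma\le 1$, and $A=\frac{1+\beta}{K\beta}$. Let $X(t)$, $t\ge 0$, be the critical continuous-time Markov branching process started from one particle, with exponential life-times of parameter $K$ and offspring p.g.f. $h(s)=s+\frac{(1-s)^{1+\beta}}{1+\beta}$, and let $Y(t)$ be the branching process with immigration obtained from $X$ when the flow of immigration is the compound Poisson process with p.g.f. $G(t,s)=\exp\{-\theta t(1-s)^\gamma\}$ and $Y(0)=0$. For a normalising function $z=z(t)>0$ set $Z(t)=z(t)Y(t)$, $\Psi(t,\lambda)=\mathbb{E}[\exp\{-\lambda Z(t)\}]$. Then the limit $\Psi(\lambda)=\lim_{t\to\infty}\Psi(t,\lambda)$ exists for every $\lambda>0$ in each of the following parameter configurations and normalisations, and is given as follows. 1) If $0<\gamma=\beta\le 1$ and $\frac{t}{A}=z^{-\beta}$, then $\Psi(\lambda)=\left(\frac{1}{1+\lambda^\beta}\right)^{\theta A}$ for $\lambda>0$. 2) If $0<\gamma<\beta\le 1$ and $\frac{t}{A}=z^{-\gamma}$, then $\Psi(\lambda)=\exp\{-\theta A\lambda^\gamma\}$ for $\lambda>0$. 3) If $0<\gamma<\beta\le 1$ and $\frac{t}{A}=z^{-\beta}$, then $\Psi(\lambda)=0$ for $\lambda>0$. 4) If $0<\beta<\gamma\le 1$ and $\frac{t}{A}=z^{-\beta}$, then $\Psi(\lambda)=1$ for $\lambda>0$. 5) If $0<\beta<\gamma\le 1$ and $\frac{t}{A}=z^{-\gamma}$, then $\Psi(\lambda)=1$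 for $\lambda>0$.
   Context: The p.g.f. (probability generating function) of a nonnegative-integer-valued random variable $N$ is $s\mapsto\mathbb{E}[s^N]$, $|s|\le 1$. Falling factorial: $[a]_{k\downarrow}=a(a-1)\cdots(a-k+1)$. Branching process without immigration: $X(t)$, $t\ge 0$, is the continuous-time Markov branching process with $X(0)=1$ in which each particle lives independently an exponential time of parameter $K$ and at death is replaced by a random number of particles with p.g.f. $h$. Its infinitesimal generating function is $f(s)=K(h(s)-s)=K\frac{(1-s)^{1+\beta}}{1+\beta}$, and $F(t,s)=\mathbb{E}[s^{X(t)}]$ solves the backward Kolmogorov equation $\frac{d}{dt}F(t,s)=\frac{K}{1+\beta}(1-F(t,s))^{1+\beta}$, $F(0,s)=s$, with explicit solution $$1-F(t,s)=(1-s)\left\{1+\frac{K\beta(1-s)^\beta t}{1+\beta}\right\}^{-1/\beta}.$$ Immigration: immigrants arrive in groups at the jump times $0<\tau_1<\tau_2<\cdots$ of a homogeneous Poisson process $N(t)$ of rate $\theta$, i.e. $\mathbb{E}[s^{N(t)}]=\exp\{-\theta t(1-s)\}$. The group sizes $I_1,I_2,\dots$ are i.i.d. with Sibuya p.g.f. $g(s)=\mathbb{E}[s^{I_n}]=1-(1-s)^\gamma$, that is, $P(I_n=k)=(-1)^{k-1}\frac{[\gamma]_{k\downarrow}}{k!}$, $k=1,2,\dots$ (for $\gamma=1$ this means $I_n=1$). Thus the immigration flow is the compound Poisson process with p.g.f. $G(t,s)=\exp\{-\theta t(1-g(s))\}=\exp\{-\theta t(1-s)^\gamma\}$. Branching process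 with immigration: $$Y(t)=\sum_{i=1}^{N(t)}\sum_{j=1}^{I_i}X_{i,j}(t-\tau_i),\qquad t\ge 0,$$ where the $X_{i,j}$ are independent copies of the process $X$; the Poisson process, the group sizes and the processes $X_{i,j}$ are mutually independent. The normalisation $\frac{t}{A}=z^{-\beta}$ means $z(t)=(A/t)^{1/\beta}$, and $\frac{t}{A}=z^{-\gamma}$ means $z(t)=(A/t)^{1/\gamma}$, for $t>0$; in both cases $z(t)\to 0$ as $t\to\infty$. *)

theory Defs
  imports "HOL-Probability.Probability"
begin

definition pgf :: "'a measure \<Rightarrow> ('a \<Rightarrow> nat) \<Rightarrow> real \<Rightarrow> real" where
  "pgf M N s = (\<integral>\<omega>. s ^ N \<omega> \<partial>M)"


section \<open>Markov branching process\<close>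

text \<open>
  Particles carry Ulam--Harris labels: the ancestor is \<open>[]\<close>, and the children of \<open>u\<close> are
  \<open>u @ [k]\<close> for \<open>k < C u\<close>, where \<open>C u\<close> is the number of particles that replace \<open>u\<close> at its death
  and \<open>L u\<close> is the life-time of \<open>u\<close>.  A particle is alive on the half-open interval
  from its birth (included) to its death (excluded).
\<close>

definition birth_time :: "(nat list \<Rightarrow> 'a \<Rightarrow> real) \<Rightarrow> nat list \<Rightarrow> 'a \<Rightarrow> real" where
  "birth_time L u \<omega> = (\<Sum>k<length u. L (take k u) \<omega>)"

definition alive :: "(nat list \<Rightarrow> 'a \<Rightarrow> real) \<Rightarrow> (nat list \<Rightarrow> 'a \<Rightarrow> nat) \<Rightarrow> real \<Rightarrow> 'a \<Rightarrow> nat list set" where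
  "alive L C t \<omega> = {u. (\<forall>k<length u. u ! k < C (take k u) \<omega>) \<and>
     birth_time L u \<omega> \<le> t \<and> t < birth_time L u \<omega> + L u \<omega>}"

text \<open>
  The cardinality of an infinite set is 0.  This convention only matters on the explosion event,
  which is a null set for a critical process.
\<close>

definition branching_process :: "(nat list \<Rightarrow> 'a \<Rightarrow> real) \<Rightarrow> (nat list \<Rightarrow> 'a \<Rightarrow> nat) \<Rightarrow> real \<Rightarrow> 'a \<Rightarrow> nat" where
  "branching_process L C t \<omega> = card (alive L C t \<omega>)"


section \<open>Immigration\<close>

definition poisson_process :: "'a measure \<Rightarrow> real \<Rightarrow> (real \<Rightarrow> 'a \<Rightarrow> nat) \<Rightarrow> bool" where
  "poisson_process M \<theta> N \<longleftrightarrow>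
     (\<forall>t\<ge>0. N t \<in> measurable M (count_space UNIV)) \<and>
     (\<forall>\<omega>\<in>space M. N 0 \<omega> = 0 \<and> mono_on {0..} (\<lambda>t. N t \<omega>) \<and>
        (\<forall>t\<ge>0. continuous (at_right t) (\<lambda>t. N t \<omega>))) \<and>
     (\<forall>s t. 0 \<le> s \<and> s < t \<longrightarrow>
        distr M (count_space UNIV) (\<lambda>\<omega>. N t \<omega> - N s \<omega>) = measure_pmf (poisson_pmf (\<theta> * (t - s)))) \<and>
     (\<forall>r m. 0 \<le> r 0 \<and> incseq r \<longrightarrow>
        prob_space.indep_vars M (\<lambda>_. count_space UNIV) (\<lambda>k \<omega>. N (r (Suc k)) \<omega> - N (r k) \<omega>) {..<m::nat})"

text \<open>
  Jumps, immigrant groups and the immigrants within a group are numbered from 0, so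
  \<open>jump_time N i\<close> is the time of the \<open>(i + 1)\<close>-st jump; it is only used when \<open>i < N t \<omega>\<close> for some \<open>t \<ge> 0\<close>.
\<close>

definition jump_time :: "(real \<Rightarrow> 'a \<Rightarrow> nat) \<Rightarrow> nat \<Rightarrow> 'a \<Rightarrow> real" where
  "jump_time N i \<omega> = Inf {t. 0 \<le> t \<and> i < N t \<omega>}"

definition immigration_process ::
  "(real \<Rightarrow> 'a \<Rightarrow> nat) \<Rightarrow> (nat \<Rightarrow> 'a \<Rightarrow> nat) \<Rightarrow> (nat \<Rightarrow> nat \<Rightarrow> nat list \<Rightarrow> 'a \<Rightarrow> real) \<Rightarrow>
   (nat \<Rightarrow> nat \<Rightarrow> nat list \<Rightarrow> 'a \<Rightarrow> nat) \<Rightarrow> real \<Rightarrow> 'a \<Rightarrow> nat" where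
  "immigration_process N I L C t \<omega> =
     (\<Sum>i<N t \<omega>. \<Sum>j<I i \<omega>. branching_process (L i j) (C i j) (t - jump_time N i \<omega>) \<omega>)"

text \<open>
  The random variables take values in different types, so their joint independence is
  stated for the generated sigma-algebras, indexed by a sum type.  The flow as a whole is one
  source: its increments are independent, but its values are not.
\<close>

datatype source =
    Flow
  | Group_Size nat
  | Life_Time nat nat "nat list"
  | Offspring nat nat "nat list"

fun source_events ::
  "'a measure \<Rightarrow> (real \<Rightarrow> 'a \<Rightarrow> nat) \<Rightarrow> (nat \<Rightarrow> 'a \<Rightarrow> nat) \<Rightarrow>
   (nat \<Rightarrow> nat \<Rightarrow> nat list \<Rightarrow> 'a \<Rightarrow> real) \<Rightarrow> (nat \<Rightarrow> nat \<Rightarrow> nat list \<Rightarrow> 'a \<Rightarrow> nat) \<Rightarrow>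
   source \<Rightarrow> 'a set set" where
  "source_events M N I L C Flow =
     sigma_sets (space M) (\<Union>t\<in>{0..}. sets (vimage_algebra (space M) (N t) (count_space UNIV)))"
| "source_events M N I L C (Group_Size i) = sets (vimage_algebra (space M) (I i) (count_space UNIV))"
| "source_events M N I L C (Life_Time i j u) = sets (vimage_algebra (space M) (L i j u) borel)"
| "source_events M N I L C (Offspring i j u) = sets (vimage_algebra (space M) (C i j u) (count_space UNIV))"


section \<open>Laplace transform of the normalised process\<close>

definition normalised_laplace :: "'a measure \<Rightarrow> (real \<Rightarrow> 'a \<Rightarrow> nat) \<Rightarrow> (real \<Rightarrow> real) \<Rightarrow> real \<Rightarrow> real \<Rightarrow> real" where
  "normalised_laplace M Y z t lam = (\<integral>\<omega>. exp (- lam * (z t * real (Y t \<omega>))) \<partial>M)"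

end

theory Submission
  imports Defs
begin

text \<open>
  Everything rests on two formulas.  Write \<open>F(t, s)\<close> for the p.g.f. of the population descending from one
  particle.  Then
  \<open>1 - F(t, s) = (1 - s) (1 + (1 - s)\<^sup>\<beta> t / A)^(-1/\<beta>)\<close>, and the process with immigration satisfies
  \<open>E[s^Y(t)] = exp (- \<theta> J)\<close> with \<open>J = \<integral>\<^sub>0\<^sup>t (1 - F(u, s))\<^sup>\<gamma> du\<close>
  (\<open>pgf_immigration_process\<close>).  With \<open>s = exp (- \<lambda> z(t))\<close> one has \<open>1 - s \<sim> \<lambda> z(t)\<close>, and the five
  limits are the limits of \<open>J\<close>.  Since the integrand decreases in \<open>u\<close>, \<open>J\<close> lies between
  \<open>t (1 - F(t, s))\<^sup>\<gamma>\<close> and \<open>t (1 - s)\<^sup>\<gamma>\<close>, which settles both cases \<open>\<gamma> < \<beta>\<close>; for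
  \<open>\<gamma> = \<beta>\<close> the integral is a logarithm, and for \<open>\<gamma> > \<beta>\<close> the integral over the whole half-line is
  finite, of order \<open>(1 - s)^(\<gamma>-\<beta>)\<close>, so that \<open>J\<close> tends to 0 as soon as \<open>z(t)\<close> does
  (\<open>survival_integral_limits\<close>).

  The formula for \<open>F\<close> comes from splitting the tree at the death of the ancestor.  This gives the
  renewal equation \<open>w(t) = s e^(-Kt) + \<integral>\<^sub>0\<^sup>t K e^(-Ku) h(w(t - u)) du\<close>, except that the subtrees
  are a priori allowed different functions \<open>w\<close>.  Because \<open>h\<close> is nonexpansive on \<open>[0, 1]\<close>, one splitting
  multiplies the distance from the solution \<open>F\<close> of the Kolmogorov equation by at most
  \<open>1 - e^(-Kt) < 1\<close>, uniformly over all trees; iteration identifies \<open>w\<close> with \<open>F\<close>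
  (\<open>expectation_population_weight\<close>).  To keep the splitting exact, an infinite population is given
  weight 0 instead of \<open>s\<^sup>0\<close>.  That explosion is a null event then follows by letting \<open>s\<close> tend to 1.

  For the immigration, one conditions on the flow: given the arrival times \<open>\<tau>\<^sub>i\<close>, the groups
  contribute independent factors \<open>1 - (1 - F(t - \<tau>\<^sub>i, s))\<^sup>\<gamma>\<close>.  The expectation of a product of
  \<open>\<phi>(\<tau>\<^sub>i)\<close> over the jumps of a Poisson process is computed without the joint law of the \<open>\<tau>\<^sub>i\<close>:
  rounding the jumps down to a grid turns the product into one over independent Poisson increments,
  and the exponent is a Riemann sum (\<open>expectation_prod_poisson_process\<close>).
\<close>


section \<open>Independent sources of randomness\<close>

locale independent_sources = prob_space M for M :: "'a measure" +
  fixes E :: "'i \<Rightarrow> 'a set set"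
  assumes indep_sources: "indep_sets E UNIV"
    and Int_stable_sources: "Int_stable (E i)"
begin

text \<open>
  Conditioning is expressed by sub-sigma-algebras of \<open>M\<close> on the same sample space.  They are
  represented as measure spaces so that the measurability prover applies to them; all integrals are
  taken with respect to \<open>M\<close>.
\<close>

definition gen :: "'i set \<Rightarrow> 'a measure" where
  "gen J = sigma (space M) (\<Union>i\<in>J. E i)"

lemma sources_events: "E i \<subseteq> events"
  using indep_sources by (auto simp: indep_sets_def)

lemma sources_Pow: "(\<Union>i\<in>J. E i) \<subseteq> Pow (space M)"
  using sources_events sets.space_closed by blast

lemma space_gen [simp]: "space (gen J) = space M"
  unfolding gen_def using sources_Pow by (rule space_measure_of)

lemma sets_gen: "sets (gen J) = sigma_sets (space M) (\<Union>i\<in>J. E i)"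
  unfolding gen_def using sources_Pow by (rule sets_measure_of)

lemma sets_gen_subset_events: "sets (gen J) \<subseteq> events"
  unfolding sets_gen using sources_events by (intro sets.sigma_sets_subset) auto

lemma measurable_gen_mono: "f \<in> measurable (gen J) N \<Longrightarrow> J \<subseteq> J' \<Longrightarrow> f \<in> measurable (gen J') N"
  by (rule subsetD[OF measurable_mono]) (auto simp: sets_gen intro!: sigma_sets_subseteq)

lemma measurable_gen: "f \<in> measurable (gen J) N \<Longrightarrow> f \<in> measurable M N"
  by (rule subsetD[OF measurable_mono]) (use sets_gen_subset_events in auto)

lemma measurable_gen_singleI:
  assumes "f \<in> space M \<rightarrow> space N" and "\<And>B. B \<in> sets N \<Longrightarrow> f -` B \<inter> space M \<in> E i"
  shows "f \<in> measurable (gen {i}) N"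
  using assms by (auto simp: measurable_def sets_gen)

lemma indep_sets_gen:
  assumes "disjoint_family_on J K"
  shows "indep_sets (\<lambda>k. sets (gen (J k))) K"
  unfolding sets_gen
  by (rule indep_sets_collect_sigma)
     (use assms Int_stable_sources indep_sets_mono_index[OF subset_UNIV indep_sources] in auto)

lemma measurable_ident_gen: "(\<lambda>\<omega>. \<omega>) \<in> measurable M (gen J)"
  using sets_gen_subset_events by (auto simp: measurable_def intro!: sets.Int)

text \<open>
  This replaces conditioning on \<open>J1\<close>: under independence, the diagonal map \<open>\<omega> \<mapsto> (\<omega>, \<omega>)\<close> has the
  product law on the two sub-sigma-algebras, so that Fubini's theorem evaluates the \<open>J2\<close>-part with
  the \<open>J1\<close>-part held fixed.
\<close>

lemma decouple:
  fixes f :: "'a \<times> 'a \<Rightarrow> real"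
  assumes "J1 \<inter> J2 = {}"
    and f[measurable]: "f \<in> borel_measurable (gen J1 \<Otimes>\<^sub>M gen J2)"
    and bounded: "\<And>x. \<bar>f x\<bar> \<le> B"
  shows "(\<integral>\<omega>. f (\<omega>, \<omega>) \<partial>M) = (\<integral>\<omega>. (\<integral>\<omega>'. f (\<omega>, \<omega>') \<partial>M) \<partial>M)"
    and "(\<lambda>\<omega>. \<integral>\<omega>'. f (\<omega>, \<omega>') \<partial>M) \<in> borel_measurable (gen J1)"
proof -
  let ?F1 = "gen J1" and ?F2 = "gen J2"
  note measurable_ident_gen[measurable]
  have F: "sigma_sets (space M) {(\<lambda>\<omega>. \<omega>) -` A \<inter> space M | A. A \<in> sets (gen J)} = sets (gen J)" for J
  proof -
    have "{(\<lambda>\<omega>. \<omega>) -` A \<inter> space M | A. A \<in> sets (gen J)} = sets (gen J)"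
      using sets.sets_into_space[of _ "gen J"] by (auto simp: Int_absorb2)
    then show ?thesis
      using sets.sigma_sets_eq[of "gen J"] by simp
  qed
  have "indep_sets (\<lambda>b. sets (gen (case_bool J1 J2 b))) UNIV"
    by (rule indep_sets_gen) (use assms(1) in \<open>auto simp: disjoint_family_on_def split: bool.splits\<close>)
  then have "indep_set (sets ?F1) (sets ?F2)"
    unfolding indep_set_def by (rule back_subst[of "\<lambda>x. indep_sets x UNIV"]) (auto split: bool.splits)
  then have "indep_var ?F1 (\<lambda>\<omega>. \<omega>) ?F2 (\<lambda>\<omega>. \<omega>)"
    unfolding indep_var_eq F by simp
  then have D: "distr M ?F1 (\<lambda>\<omega>. \<omega>) \<Otimes>\<^sub>M distr M ?F2 (\<lambda>\<omega>. \<omega>) = distr M (?F1 \<Otimes>\<^sub>M ?F2) (\<lambda>\<omega>. (\<omega>, \<omega>))"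
    by (simp add: indep_var_distribution_eq)
  interpret D1: prob_space "distr M ?F1 (\<lambda>\<omega>. \<omega>)" by (rule prob_space_distr) simp
  interpret D2: prob_space "distr M ?F2 (\<lambda>\<omega>. \<omega>)" by (rule prob_space_distr) simp
  interpret P: pair_prob_space "distr M ?F1 (\<lambda>\<omega>. \<omega>)" "distr M ?F2 (\<lambda>\<omega>. \<omega>)" ..
  have int: "integrable (distr M ?F1 (\<lambda>\<omega>. \<omega>) \<Otimes>\<^sub>M distr M ?F2 (\<lambda>\<omega>. \<omega>)) f"
    by (rule P.integrable_const_bound[where B = B]) (use bounded in auto)
  have inner: "(\<integral>\<omega>'. f (\<omega>, \<omega>') \<partial>distr M ?F2 (\<lambda>\<omega>. \<omega>)) = (\<integral>\<omega>'. f (\<omega>, \<omega>') \<partial>M)"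
    if "\<omega> \<in> space M" for \<omega>
  proof -
    have [measurable]: "(\<lambda>\<omega>'. f (\<omega>, \<omega>')) \<in> borel_measurable ?F2"
      using measurable_Pair2[OF f, of \<omega>] that by simp
    show ?thesis
      by (subst integral_distr) auto
  qed
  have [measurable]: "(\<lambda>\<omega>. \<integral>\<omega>'. f (\<omega>, \<omega>') \<partial>distr M ?F2 (\<lambda>\<omega>. \<omega>)) \<in> borel_measurable ?F1"
    using int by (intro D2.borel_measurable_lebesgue_integral) auto
  show "(\<lambda>\<omega>. \<integral>\<omega>'. f (\<omega>, \<omega>') \<partial>M) \<in> borel_measurable ?F1"
    by (subst measurable_cong[OF inner[symmetric]]) auto
  have "(\<integral>\<omega>. f (\<omega>, \<omega>) \<partial>M) = integral\<^sup>L (distr M (?F1 \<Otimes>\<^sub>M ?F2) (\<lambda>\<omega>. (\<omega>, \<omega>))) f"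
    by (subst integral_distr) auto
  also have "\<dots> = (\<integral>\<omega>. (\<integral>\<omega>'. f (\<omega>, \<omega>') \<partial>distr M ?F2 (\<lambda>\<omega>. \<omega>)) \<partial>distr M ?F1 (\<lambda>\<omega>. \<omega>))"
    unfolding D[symmetric] using P.integral_fst'[OF int] by simp
  also have "\<dots> = (\<integral>\<omega>. (\<integral>\<omega>'. f (\<omega>, \<omega>') \<partial>distr M ?F2 (\<lambda>\<omega>. \<omega>)) \<partial>M)"
    by (subst integral_distr) auto
  also have "\<dots> = (\<integral>\<omega>. (\<integral>\<omega>'. f (\<omega>, \<omega>') \<partial>M) \<partial>M)"
    by (rule Bochner_Integration.integral_cong[OF refl inner])
  finally show "(\<integral>\<omega>. f (\<omega>, \<omega>) \<partial>M) = (\<integral>\<omega>. (\<integral>\<omega>'. f (\<omega>, \<omega>') \<partial>M) \<partial>M)" .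
qed

lemma expectation_prod:
  fixes V :: "nat \<Rightarrow> 'a \<Rightarrow> real"
  assumes "disjoint_family_on J {..<n}"
    and V: "\<And>k. k < n \<Longrightarrow> V k \<in> borel_measurable (gen (J k))"
    and bounded: "\<And>k \<omega>. \<bar>V k \<omega>\<bar> \<le> 1"
  shows "expectation (\<lambda>\<omega>. \<Prod>k<n. V k \<omega>) = (\<Prod>k<n. expectation (V k))"
proof (rule indep_vars_lebesgue_integral)
  show "integrable M (V k)" if "k \<in> {..<n}" for k
    by (rule integrable_const_bound[where B = 1])
       (use that V[THEN measurable_gen] bounded in auto)
  have "indep_sets (\<lambda>k. {V k -` A \<inter> space M | A. A \<in> sets borel}) {..<n}"
  proof (rule indep_sets_mono_sets[OF indep_sets_gen[OF assms(1)]])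
    show "{V k -` A \<inter> space M | A. A \<in> sets borel} \<subseteq> sets (gen (J k))" if "k \<in> {..<n}" for k
      using measurable_sets[OF V[of k]] that by auto
  qed
  then show "indep_vars (\<lambda>_. borel) V {..<n}"
    unfolding indep_vars_def2 using V[THEN measurable_gen] by auto
qed simp

text \<open>
  Both the number of children and the size of an immigrant group enter as random ranges of products.
\<close>

lemma expectation_random_prod:
  fixes V :: "nat \<Rightarrow> 'a \<Rightarrow> real" and C :: "'a \<Rightarrow> nat"
  assumes disjoint: "disjoint_family J" "\<And>k. J0 \<inter> J k = {}"
    and C[measurable]: "C \<in> measurable (gen J0) (count_space UNIV)"
    and V: "\<And>k. V k \<in> borel_measurable (gen (J k))"
    and bounded: "\<And>k \<omega>. \<bar>V k \<omega>\<bar> \<le> 1"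
  shows "expectation (\<lambda>\<omega>. \<Prod>k<C \<omega>. V k \<omega>) = expectation (\<lambda>\<omega>. \<Prod>k<C \<omega>. expectation (V k))"
proof -
  have [measurable]: "V k \<in> borel_measurable (gen (\<Union>k. J k))" for k
    using V by (rule measurable_gen_mono) auto
  have "(\<lambda>x. \<Prod>k<C (fst x). V k (snd x)) \<in> borel_measurable (gen J0 \<Otimes>\<^sub>M gen (\<Union>k. J k))"
    by (rule measurable_compose_countable[where g = "\<lambda>x. C (fst x)"]) measurable
  moreover have "\<bar>\<Prod>k<C (fst x). V k (snd x)\<bar> \<le> 1" for x
    using bounded by (auto simp: abs_prod intro!: prod_le_1)
  moreover have "J0 \<inter> (\<Union>k. J k) = {}"
    using disjoint by auto
  ultimately have "expectation (\<lambda>\<omega>. \<Prod>k<C \<omega>. V k \<omega>) =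
      expectation (\<lambda>\<omega>. expectation (\<lambda>\<omega>'. \<Prod>k<C \<omega>. V k \<omega>'))"
    using decouple(1)[of J0 "\<Union>k. J k" "\<lambda>x. \<Prod>k<C (fst x). V k (snd x)" 1] by simp
  also have "\<dots> = expectation (\<lambda>\<omega>. \<Prod>k<C \<omega>. expectation (V k))"
    by (intro Bochner_Integration.integral_cong refl expectation_prod[where J = J] V bounded)
       (use disjoint in \<open>auto simp: disjoint_family_on_def\<close>)
  finally show ?thesis .
qed

end


section \<open>The population as a random set of labels\<close>

lemma birth_time_Nil [simp]: "birth_time L [] \<omega> = 0"
  by (simp add: birth_time_def)

lemma birth_time_Cons:
  "birth_time L (k # u) \<omega> = L [] \<omega> + birth_time (\<lambda>u. L (k # u)) u \<omega>"
  by (simp add: birth_time_def sum.lessThan_Suc_shift del: sum.lessThan_Suc)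

lemma Nil_in_alive_iff: "[] \<in> alive L C t \<omega> \<longleftrightarrow> 0 \<le> t \<and> t < L [] \<omega>"
  by (simp add: alive_def)

lemma Cons_in_alive_iff:
  "k # u \<in> alive L C t \<omega> \<longleftrightarrow>
     k < C [] \<omega> \<and> u \<in> alive (\<lambda>u. L (k # u)) (\<lambda>u. C (k # u)) (t - L [] \<omega>) \<omega>"
  by (simp add: alive_def birth_time_Cons All_less_Suc2) (auto simp: algebra_simps)

text \<open>
  After the death of the ancestor, the population is the disjoint union of the populations of the
  child trees, each with its clock started at that death.
\<close>

lemma alive_after_first_death:
  assumes "L [] \<omega> \<le> t"
  shows "alive L C t \<omega> =
    (\<Union>k<C [] \<omega>. (#) k ` alive (\<lambda>u. L (k # u)) (\<lambda>u. C (k # u)) (t - L [] \<omega>) \<omega>)" (is "_ = ?R")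
proof (rule set_eqI)
  show "u \<in> alive L C t \<omega> \<longleftrightarrow> u \<in> ?R" for u
    using assms by (cases u) (auto simp: Nil_in_alive_iff Cons_in_alive_iff)
qed

lemma alive_before_first_death:
  assumes "0 \<le> t" "t < L [] \<omega>" and nonneg: "\<And>u. 0 \<le> L u \<omega>"
  shows "alive L C t \<omega> = {[]}"
proof -
  have "k # u \<notin> alive L C t \<omega>" for k u
  proof -
    have "0 \<le> birth_time (\<lambda>u. L (k # u)) u \<omega>"
      unfolding birth_time_def by (intro sum_nonneg nonneg)
    then show ?thesis
      using assms(2) by (auto simp: alive_def birth_time_Cons)
  qed
  then have "u \<in> alive L C t \<omega> \<longleftrightarrow> u \<in> {[]}" for u
    using assms(1,2) by (cases u) (auto simp: Nil_in_alive_iff)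
  then show ?thesis by blast
qed

text \<open>
  This is \<open>s\<close> to the power of the number of living particles, with \<open>s\<^sup>\<infinity> = 0\<close>.  For the plain cardinality,
  which is 0 on an infinite set, the product rule below fails when some, but not all, of the child
  trees have exploded.
\<close>

definition population_weight ::
  "(nat list \<Rightarrow> 'a \<Rightarrow> real) \<Rightarrow> (nat list \<Rightarrow> 'a \<Rightarrow> nat) \<Rightarrow> real \<Rightarrow> real \<Rightarrow> 'a \<Rightarrow> real" where
  "population_weight L C s t \<omega> =
     (if finite (alive L C t \<omega>) then s ^ branching_process L C t \<omega> else 0)"

lemma population_weight_bounds:
  assumes "0 \<le> s" "s \<le> 1"
  shows "0 \<le> population_weight L C s t \<omega>" "population_weight L C s t \<omega> \<le> 1"
  using assms by (auto simp: population_weight_def power_le_one)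

lemma population_weight_before_first_death:
  assumes "0 \<le> t" "t < L [] \<omega>" "\<And>u. 0 \<le> L u \<omega>"
  shows "population_weight L C s t \<omega> = s"
  by (simp add: population_weight_def branching_process_def alive_before_first_death[of t L \<omega> C] assms)

lemma population_weight_after_first_death:
  assumes "L [] \<omega> \<le> t"
  shows "population_weight L C s t \<omega> =
    (\<Prod>k<C [] \<omega>. population_weight (\<lambda>u. L (k # u)) (\<lambda>u. C (k # u)) s (t - L [] \<omega>) \<omega>)"
proof -
  define A where "A k = alive (\<lambda>u. L (k # u)) (\<lambda>u. C (k # u)) (t - L [] \<omega>) \<omega>" for k
  have alive: "alive L C t \<omega> = (\<Union>k<C [] \<omega>. (#) k ` A k)"
    unfolding A_def using assms by (rule alive_after_first_death)
  show ?thesis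
  proof (cases "\<forall>k<C [] \<omega>. finite (A k)")
    case True
    have "card (\<Union>k<C [] \<omega>. (#) k ` A k) = (\<Sum>k<C [] \<omega>. card ((#) k ` A k))"
      using True by (intro card_UN_disjoint) auto
    also have "\<dots> = (\<Sum>k<C [] \<omega>. card (A k))"
      by (intro sum.cong refl card_image) auto
    finally show ?thesis
      using True
      by (auto simp: population_weight_def branching_process_def alive A_def[symmetric] power_sum
          intro!: prod.cong)
  next
    case False
    then obtain k where k: "k < C [] \<omega>" "infinite (A k)" by auto
    then have "infinite ((#) k ` A k)"
      by (subst finite_image_iff) auto
    then have "infinite (alive L C t \<omega>)"
      unfolding alive using k(1) by (meson UN_upper finite_subset lessThan_iff)
    then have "population_weight L C s t \<omega> = 0"
      by (simp add: population_weight_def)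
    moreover have "(\<Prod>k<C [] \<omega>. population_weight (\<lambda>u. L (k # u)) (\<lambda>u. C (k # u)) s (t - L [] \<omega>) \<omega>) = 0"
      using k by (intro prod_zero) (auto simp: population_weight_def A_def)
    ultimately show ?thesis by simp
  qed
qed

text \<open>
  The population is a random subset of the countable set of labels.  Transporting it to the natural
  numbers by \<open>to_nat\<close> makes finiteness and cardinality measurable.
\<close>

lemma measurable_finite_countable:
  fixes S :: "'a \<Rightarrow> 'b::countable set"
  assumes [measurable]: "\<And>u. Measurable.pred M (\<lambda>x. u \<in> S x)"
  shows "Measurable.pred M (\<lambda>x. finite (S x))"
proof -
  have *: "finite A \<longleftrightarrow> (\<exists>n. \<forall>u. u \<in> A \<longrightarrow> to_nat u < n)" for A :: "'b set"
    using finite_nat_iff_bounded[of "to_nat ` A"] finite_image_iff[of to_nat A] by auto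
  show ?thesis
    unfolding * by measurable
qed

lemma measurable_card_countable:
  fixes S :: "'a \<Rightarrow> 'b::countable set"
  assumes S[measurable]: "\<And>u. Measurable.pred M (\<lambda>x. u \<in> S x)"
  shows "(\<lambda>x. card (S x)) \<in> measurable M (count_space UNIV)"
proof -
  have *: "card (S x) = card (to_nat ` S x)" for x
    by (simp add: card_image)
  have "{x \<in> space M. i \<in> to_nat ` S x} \<in> sets M" for i :: nat
  proof -
    have "i \<in> to_nat ` S x \<longleftrightarrow> (\<exists>u. i = to_nat u \<and> u \<in> S x)" for x by auto
    then show ?thesis by simp
  qed
  then show ?thesis
    unfolding * by (rule measurable_card)
qed

text \<open>
  Joint measurability in time and chance is needed because the trees are observed at random ages: a
  child tree at the time elapsed since its parent's death, an immigrant at the time since its arrival.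
\<close>

lemma
  assumes [measurable]: "\<And>u. L u \<in> borel_measurable G" "\<And>u. C u \<in> measurable G (count_space UNIV)"
  shows measurable_alive: "Measurable.pred (borel \<Otimes>\<^sub>M G) (\<lambda>x. u \<in> alive L C (fst x) (snd x))"
    and measurable_branching_process:
      "(\<lambda>x. branching_process L C (fst x) (snd x)) \<in> measurable (borel \<Otimes>\<^sub>M G) (count_space UNIV)"
    and measurable_population_weight:
      "(\<lambda>x. population_weight L C s (fst x) (snd x)) \<in> borel_measurable (borel \<Otimes>\<^sub>M G)"
proof -
  have [measurable]: "Measurable.pred (borel \<Otimes>\<^sub>M G) (\<lambda>x. u \<in> alive L C (fst x) (snd x))" for u
    unfolding alive_def birth_time_def by simp
  then show "Measurable.pred (borel \<Otimes>\<^sub>M G) (\<lambda>x. u \<in> alive L C (fst x) (snd x))" .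
  have [measurable]: "Measurable.pred (borel \<Otimes>\<^sub>M G) (\<lambda>x. finite (alive L C (fst x) (snd x)))"
    by (rule measurable_finite_countable) simp
  show [measurable]:
    "(\<lambda>x. branching_process L C (fst x) (snd x)) \<in> measurable (borel \<Otimes>\<^sub>M G) (count_space UNIV)"
    unfolding branching_process_def by (rule measurable_card_countable) simp
  show "(\<lambda>x. population_weight L C s (fst x) (snd x)) \<in> borel_measurable (borel \<Otimes>\<^sub>M G)"
    unfolding population_weight_def by simp
qed


section \<open>The branching property and uniqueness\<close>

context independent_sources
begin

text \<open>
  The labellings \<open>\<iota>\<close> and \<open>\<kappa>\<close> name the sources of randomness behind the life-times and the offspring
  numbers.  Injectivity and disjointness of ranges pass to subtrees, which is what makes
  induction over the generations possible without reindexing the independent family.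
\<close>

definition branching_tree ::
  "real \<Rightarrow> (real \<Rightarrow> real) \<Rightarrow> (nat list \<Rightarrow> 'a \<Rightarrow> real) \<Rightarrow> (nat list \<Rightarrow> 'a \<Rightarrow> nat) \<Rightarrow>
   (nat list \<Rightarrow> 'i) \<Rightarrow> (nat list \<Rightarrow> 'i) \<Rightarrow> bool" where
  "branching_tree K h L C \<iota> \<kappa> \<longleftrightarrow>
     inj \<iota> \<and> inj \<kappa> \<and> (\<forall>u v. \<iota> u \<noteq> \<kappa> v) \<and>
     (\<forall>u. L u \<in> borel_measurable (gen {\<iota> u})) \<and>
     (\<forall>u. C u \<in> measurable (gen {\<kappa> u}) (count_space UNIV)) \<and>
     (\<forall>u. distributed M lborel (L u) (exponential_density K)) \<and>
     (\<forall>u. \<forall>s\<in>{0..1}. pgf M (C u) s = h s)"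

lemma branching_tree_subtree:
  assumes "branching_tree K h L C \<iota> \<kappa>"
  shows "branching_tree K h (\<lambda>u. L (k # u)) (\<lambda>u. C (k # u)) (\<lambda>u. \<iota> (k # u)) (\<lambda>u. \<kappa> (k # u))"
  using assms unfolding branching_tree_def inj_def by auto

lemma population_weight_measurable:
  assumes "branching_tree K h L C \<iota> \<kappa>" "range \<iota> \<union> range \<kappa> \<subseteq> J"
  shows "(\<lambda>x. population_weight L C s (fst x) (snd x)) \<in> borel_measurable (borel \<Otimes>\<^sub>M gen J)"
    and "population_weight L C s t \<in> borel_measurable (gen J)"
    and "branching_process L C t \<in> measurable (gen J) (count_space UNIV)"
    and "(\<lambda>x. branching_process L C (fst x) (snd x)) \<in> measurable (borel \<Otimes>\<^sub>M gen J) (count_space UNIV)"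
    and "Measurable.pred (gen J) (\<lambda>\<omega>. finite (alive L C t \<omega>))"
proof -
  have L[measurable]: "L u \<in> borel_measurable (gen J)" for u
    by (rule measurable_gen_mono[of _ "{\<iota> u}"]) (use assms in \<open>auto simp: branching_tree_def\<close>)
  have C[measurable]: "C u \<in> measurable (gen J) (count_space UNIV)" for u
    by (rule measurable_gen_mono[of _ "{\<kappa> u}"]) (use assms in \<open>auto simp: branching_tree_def\<close>)
  show W[measurable]:
    "(\<lambda>x. population_weight L C s (fst x) (snd x)) \<in> borel_measurable (borel \<Otimes>\<^sub>M gen J)"
    by (rule measurable_population_weight) simp_all
  show [measurable]:
    "(\<lambda>x. branching_process L C (fst x) (snd x)) \<in> measurable (borel \<Otimes>\<^sub>M gen J) (count_space UNIV)"
    by (rule measurable_branching_process) simp_all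
  have P[measurable]: "(\<lambda>\<omega>. (t, \<omega>)) \<in> measurable (gen J) (borel \<Otimes>\<^sub>M gen J)"
    by simp
  show "population_weight L C s t \<in> borel_measurable (gen J)"
    using measurable_compose[OF P W] by simp
  show "branching_process L C t \<in> measurable (gen J) (count_space UNIV)"
    using measurable_compose[OF P, of "\<lambda>x. branching_process L C (fst x) (snd x)"] by simp
  have "Measurable.pred (gen J) (\<lambda>\<omega>. u \<in> alive L C t \<omega>)" for u
    using measurable_compose[OF P measurable_alive[OF L C]] by simp
  then show "Measurable.pred (gen J) (\<lambda>\<omega>. finite (alive L C t \<omega>))"
    by (rule measurable_finite_countable)
qed

lemma AE_life_times_nonneg:
  assumes "branching_tree K h L C \<iota> \<kappa>" "K > 0"
  shows "AE \<omega> in M. \<forall>u. 0 \<le> L u \<omega>"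
proof (subst AE_all_countable, rule allI)
  fix u
  have D: "distributed M lborel (L u) (exponential_density K)"
    using assms(1) by (simp add: branching_tree_def)
  then have [measurable]: "L u \<in> borel_measurable M"
    by (auto simp: distributed_def)
  have "\<P>(\<omega> in M. 0 < L u \<omega>) = 1"
    using exponential_distributedD_gt[OF D _ assms(2), of 0] by simp
  then have "AE \<omega> in M. 0 < L u \<omega>"
    by (subst (asm) prob_Collect_eq_1) auto
  then show "AE \<omega> in M. 0 \<le> L u \<omega>"
    by eventually_elim simp
qed

text \<open>
  The branching property.  The ancestor's life-time, its offspring number and the child trees use
  disjoint sources, so the first two layers of randomness can be integrated out in turn: first
  everything after the death with the life-time fixed, then the child trees with their number fixed.
\<close>

lemma population_weight_first_death:
  assumes tree: "branching_tree K h L C \<iota> \<kappa>" and "K > 0" and s: "0 \<le> s" "s \<le> 1" and "0 \<le> t"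
  defines "\<Phi> \<equiv> \<lambda>u. expectation (\<lambda>\<omega>. \<Prod>k<C [] \<omega>.
      expectation (population_weight (\<lambda>v. L (k # v)) (\<lambda>v. C (k # v)) s u))"
  shows "expectation (population_weight L C s t) =
      expectation (\<lambda>\<omega>. if t < L [] \<omega> then s else \<Phi> (t - L [] \<omega>))"
    and "(\<lambda>\<omega>. if t < L [] \<omega> then s else \<Phi> (t - L [] \<omega>)) \<in> borel_measurable M"
proof -
  define sub where "sub k = range (\<lambda>u. \<iota> (k # u)) \<union> range (\<lambda>u. \<kappa> (k # u))" for k
  define J where "J = insert (\<kappa> []) (\<Union>k. sub k)"
  define W where "W k = population_weight (\<lambda>v. L (k # v)) (\<lambda>v. C (k # v)) s" for k
  \<comment> \<open>the first coordinate carries the ancestor's life-time, the second everything else\<close>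
  define f where "f x = (if t < L [] (fst x) then s
      else \<Prod>k<C [] (snd x). W k (t - L [] (fst x)) (snd x))" for x
  have inj: "inj \<iota>" "inj \<kappa>" "\<And>u v. \<iota> u \<noteq> \<kappa> v"
    using tree by (auto simp: branching_tree_def)
  have disj: "{\<iota> []} \<inter> J = {}" "disjoint_family sub" "\<And>k. {\<kappa> []} \<inter> sub k = {}"
    using inj inj(3)[symmetric] by (auto simp: J_def sub_def disjoint_family_on_def inj_eq)
  have sub: "branching_tree K h (\<lambda>u. L (k # u)) (\<lambda>u. C (k # u)) (\<lambda>u. \<iota> (k # u)) (\<lambda>u. \<kappa> (k # u))" for k
    by (rule branching_tree_subtree) (rule tree)
  have W[measurable]: "(\<lambda>x. W k (fst x) (snd x)) \<in> borel_measurable (borel \<Otimes>\<^sub>M gen J)" for k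
    unfolding W_def by (rule population_weight_measurable[OF sub]) (auto simp: J_def sub_def)
  have L[measurable]: "L [] \<in> borel_measurable (gen {\<iota> []})"
    and C: "C [] \<in> measurable (gen {\<kappa> []}) (count_space UNIV)"
    using tree by (auto simp: branching_tree_def)
  have [measurable]: "C [] \<in> measurable (gen J) (count_space UNIV)"
    using C by (rule measurable_gen_mono) (simp add: J_def)
  have W01: "0 \<le> W k u \<omega>" "W k u \<omega> \<le> 1" for k u \<omega>
    unfolding W_def by (fact population_weight_bounds[OF s])+
  have [measurable]: "(\<lambda>x. W k (t - L [] (fst x)) (snd x)) \<in> borel_measurable (gen {\<iota> []} \<Otimes>\<^sub>M gen J)" for k
    using measurable_compose[of "\<lambda>x. (t - L [] (fst x), snd x)" "gen {\<iota> []} \<Otimes>\<^sub>M gen J", OF _ W[of k]]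
    by simp
  have [measurable]: "(\<lambda>x. \<Prod>k<C [] (snd x). W k (t - L [] (fst x)) (snd x))
      \<in> borel_measurable (gen {\<iota> []} \<Otimes>\<^sub>M gen J)"
    by (rule measurable_compose_countable[where g = "\<lambda>x. C [] (snd x)"]) measurable
  have f: "f \<in> borel_measurable (gen {\<iota> []} \<Otimes>\<^sub>M gen J)"
    unfolding f_def by measurable
  have f1: "\<bar>f x\<bar> \<le> 1" for x
    unfolding f_def using W01 s by (auto simp: abs_prod intro!: prod_le_1)
  have step: "expectation (\<lambda>\<omega>'. f (\<omega>, \<omega>')) = (if t < L [] \<omega> then s else \<Phi> (t - L [] \<omega>))" for \<omega>
  proof (cases "t < L [] \<omega>")
    case False
    have "expectation (\<lambda>\<omega>'. \<Prod>k<C [] \<omega>'. W k u \<omega>') = \<Phi> u" for u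
      unfolding \<Phi>_def W_def[symmetric]
      by (rule expectation_random_prod[OF disj(2,3) C])
         (auto simp: W_def sub_def intro!: population_weight_measurable(2)[OF sub]
            abs_le_iff[THEN iffD2] W01[unfolded W_def] order_trans[OF _ W01(1)[unfolded W_def]])
    then show ?thesis
      using False by (simp add: f_def)
  qed (simp add: f_def prob_space)
  have "expectation (population_weight L C s t) = expectation (\<lambda>\<omega>. f (\<omega>, \<omega>))"
  proof (rule integral_cong_AE)
    show "AE \<omega> in M. population_weight L C s t \<omega> = f (\<omega>, \<omega>)"
      using AE_life_times_nonneg[OF tree \<open>K > 0\<close>]
      by eventually_elim
        (auto simp: f_def W_def population_weight_before_first_death population_weight_after_first_death \<open>0 \<le> t\<close>)
    show "population_weight L C s t \<in> borel_measurable M"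
      using population_weight_measurable(2)[OF tree subset_UNIV] by (rule measurable_gen)
    have "(\<lambda>\<omega>. (\<omega>, \<omega>)) \<in> measurable M (gen {\<iota> []} \<Otimes>\<^sub>M gen J)"
      by (intro measurable_Pair measurable_ident_gen)
    then show "(\<lambda>\<omega>. f (\<omega>, \<omega>)) \<in> borel_measurable M"
      using f by (rule measurable_compose)
  qed
  also have "\<dots> = expectation (\<lambda>\<omega>. expectation (\<lambda>\<omega>'. f (\<omega>, \<omega>')))"
    using disj(1) f f1 by (rule decouple)
  finally show "expectation (population_weight L C s t) =
      expectation (\<lambda>\<omega>. if t < L [] \<omega> then s else \<Phi> (t - L [] \<omega>))"
    unfolding step .
  have "(\<lambda>\<omega>. expectation (\<lambda>\<omega>'. f (\<omega>, \<omega>'))) \<in> borel_measurable M"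
    using decouple(2)[OF disj(1) f f1] by (rule measurable_gen)
  then show "(\<lambda>\<omega>. if t < L [] \<omega> then s else \<Phi> (t - L [] \<omega>)) \<in> borel_measurable M"
    unfolding step .
qed

text \<open>
  The integral form of the backward equation: \<open>- e^(-Kx) F(t - x)\<close> is an antiderivative of
  \<open>K e^(-Kx) h(F(t - x))\<close> exactly because \<open>F\<close> solves the differential equation.
\<close>

lemma expectation_first_death:
  assumes X: "distributed M lborel X (exponential_density K)" and "K > 0" "0 \<le> t"
    and h: "continuous_on {0..1} h"
    and F: "\<And>u. 0 \<le> u \<Longrightarrow> F u \<in> {0..1}" "F 0 = s"
    and deriv: "\<And>u. 0 \<le> u \<Longrightarrow> (F has_real_derivative K * (h (F u) - F u)) (at u)"
  shows "expectation (\<lambda>\<omega>. if t < X \<omega> then s else h (F (t - X \<omega>))) = F t"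
    and "(\<lambda>\<omega>. if t < X \<omega> then s else h (F (t - X \<omega>))) \<in> borel_measurable M"
proof -
  have X_meas[measurable]: "X \<in> borel_measurable M"
    using X by (auto simp: distributed_def)
  have cont_F: "continuous_on {0..} F"
    using deriv by (intro continuous_at_imp_continuous_on ballI DERIV_isCont) auto
  have cont: "continuous_on {..t} (\<lambda>x. h (F (t - x)))"
  proof (rule continuous_on_compose2[OF h])
    show "continuous_on {..t} (\<lambda>x. F (t - x))"
      by (rule continuous_on_compose2[OF cont_F]) (auto intro!: continuous_intros)
  qed (auto simp del: atLeastAtMost_iff intro!: F(1))
  define p where "p x = indicator {..t} x *\<^sub>R h (F (t - x))" for x
  have [measurable]: "p \<in> borel_measurable borel"
    unfolding p_def by (rule borel_measurable_continuous_on_indicator[OF _ cont]) simp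
  have split: "(\<lambda>\<omega>. if t < X \<omega> then s else h (F (t - X \<omega>))) =
      (\<lambda>\<omega>. p (X \<omega>) + s * indicator {\<omega>. t < X \<omega>} \<omega>)"
    by (auto simp: p_def indicator_def)
  have [measurable]: "Measurable.pred M (\<lambda>\<omega>. t < X \<omega>)"
    by measurable
  show "(\<lambda>\<omega>. if t < X \<omega> then s else h (F (t - X \<omega>))) \<in> borel_measurable M"
    unfolding split by measurable
  have "bounded (h ` {0..1})"
    by (intro compact_imp_bounded compact_continuous_image h) simp
  then obtain B where B: "\<forall>y\<in>h ` {0..1}. norm y \<le> B"
    unfolding bounded_iff by blast
  have "\<bar>h x\<bar> \<le> B" if "x \<in> {0..1}" for x
    using B that by simp
  note h_bound = this
  have "\<bar>p x\<bar> \<le> B" for x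
    using h_bound[of 0] h_bound[OF F(1), of "t - x"] by (auto simp: p_def indicator_def)
  then have int: "integrable M (\<lambda>\<omega>. p (X \<omega>))"
    by (intro integrable_const_bound[where B = B]) auto
  have "expectation (\<lambda>\<omega>. p (X \<omega>)) = (\<integral>x. exponential_density K x * p x \<partial>lborel)"
    by (rule distributed_integral[symmetric, OF X]) (auto simp: erlang_density_def \<open>K > 0\<close> less_imp_le)
  also have "\<dots> = (\<integral>x. indicator {0..t} x *\<^sub>R (K * exp (- K * x) * h (F (t - x))) \<partial>lborel)"
    by (intro Bochner_Integration.integral_cong) (auto simp: exponential_density_def p_def indicator_def)
  also have "\<dots> = - exp (- K * t) * F (t - t) - (- exp (- K * 0) * F (t - 0))"
  proof (rule integral_FTC_Icc[OF \<open>0 \<le> t\<close>])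
    fix x assume "0 \<le> x" "x \<le> t"
    then have D: "((\<lambda>x. F (t - x)) has_real_derivative K * (h (F (t - x)) - F (t - x)) * (- 1)) (at x)"
      by (intro DERIV_chain2[where f = F] deriv) (auto intro!: derivative_eq_intros)
    have E: "((\<lambda>x. - exp (- K * x)) has_real_derivative K * exp (- K * x)) (at x)"
      by (auto intro!: derivative_eq_intros)
    have "((\<lambda>x. - exp (- K * x) * F (t - x)) has_real_derivative
        K * exp (- K * x) * h (F (t - x))) (at x)"
      by (rule DERIV_cong[OF DERIV_mult[OF E D]]) (simp add: algebra_simps)
    then show "((\<lambda>x. - exp (- K * x) * F (t - x)) has_vector_derivative
        K * exp (- K * x) * h (F (t - x))) (at x within {0..t})"
      unfolding has_real_derivative_iff_has_vector_derivative[symmetric]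
      by (rule has_field_derivative_at_within)
  next
    show "continuous_on {0..t} (\<lambda>x. K * exp (- K * x) * h (F (t - x)))"
      by (intro continuous_intros continuous_on_subset[OF cont]) auto
  qed
  also have "\<dots> = F t - s * exp (- K * t)"
    using F(2) by simp
  finally have "expectation (\<lambda>\<omega>. p (X \<omega>)) = F t - s * exp (- K * t)" .
  moreover have "expectation (indicator {\<omega>. t < X \<omega>}) = exp (- K * t)"
    using exponential_distributedD_gt[OF X \<open>0 \<le> t\<close> \<open>K > 0\<close>]
    by (simp add: Collect_conj_eq Int_commute mult.commute)
  moreover have "integrable M (indicat_real {\<omega>. t < X \<omega>})"
    by (rule integrable_const_bound[where B = 1]) auto
  ultimately show "expectation (\<lambda>\<omega>. if t < X \<omega> then s else h (F (t - X \<omega>))) = F t"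
    unfolding split using int by (subst Bochner_Integration.integral_add) auto
qed

lemma pgf_bounds:
  assumes [measurable]: "C \<in> measurable M (count_space UNIV)" and x: "x \<in> {0..1}"
  shows "pgf M C x \<in> {0..1}"
proof -
  have "integrable M (\<lambda>\<omega>. x ^ C \<omega>)"
    by (rule integrable_const_bound[where B = 1]) (use x in \<open>auto simp: power_le_one\<close>)
  then show ?thesis
    unfolding pgf_def using x by (auto intro!: integral_nonneg integral_le_const simp: power_le_one)
qed

text \<open>
  Bounding the factors before averaging over \<open>C\<close> keeps the estimate in terms of the p.g.f. alone, so
  that the mean offspring number never has to be computed.
\<close>

lemma expectation_random_prod_bounds:
  fixes C :: "'a \<Rightarrow> nat" and w :: "nat \<Rightarrow> real"
  assumes [measurable]: "C \<in> measurable M (count_space UNIV)"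
    and w: "\<And>k. w k \<in> {a..b}" and ab: "0 \<le> a" "b \<le> 1"
  shows "expectation (\<lambda>\<omega>. \<Prod>k<C \<omega>. w k) \<in> {pgf M C a..pgf M C b}"
proof -
  have "a \<le> b" using w[of 0] by simp
  have w01: "0 \<le> w k" "w k \<le> 1" "a \<le> w k" "w k \<le> b" for k
    using w[of k] ab by auto
  have [measurable]: "(\<lambda>\<omega>. \<Prod>k<C \<omega>. w k) \<in> borel_measurable M"
    by (rule measurable_compose_countable[where g = C]) auto
  have int: "integrable M (\<lambda>\<omega>. x ^ C \<omega>)" if "0 \<le> x" "x \<le> 1" for x :: real
    by (rule integrable_const_bound[where B = 1]) (use that in \<open>auto simp: power_le_one\<close>)
  have int': "integrable M (\<lambda>\<omega>. \<Prod>k<C \<omega>. w k)"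
    by (rule integrable_const_bound[where B = 1]) (use w01 in \<open>auto simp: abs_prod intro!: prod_le_1\<close>)
  have "a ^ C \<omega> \<le> (\<Prod>k<C \<omega>. w k)" "(\<Prod>k<C \<omega>. w k) \<le> b ^ C \<omega>" for \<omega>
    using w01 ab prod_mono[of "{..<C \<omega>}" "\<lambda>_. a" w] prod_mono[of "{..<C \<omega>}" w "\<lambda>_. b"] by auto
  then show ?thesis
    unfolding pgf_def atLeastAtMost_iff using ab \<open>a \<le> b\<close>
    by (intro conjI integral_mono int int') auto
qed

text \<open>
  Uniqueness by contraction.  The weights of the subtrees are not known to be equally distributed, so
  the bound is proved for all trees and all times up to \<open>t\<close> at once: if every tree is within \<open>c\<close> of
  \<open>F\<close>, then after one splitting at the first death every tree is within \<open>c (1 - e^(-Kt))\<close>, because \<open>h\<close>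
  is nonexpansive and an error only arises when the ancestor has died.
\<close>

theorem expectation_population_weight:
  assumes "K > 0" and s: "0 \<le> s" "s \<le> 1"
    and h: "\<And>x y. x \<in> {0..1} \<Longrightarrow> y \<in> {0..1} \<Longrightarrow> \<bar>h x - h y\<bar> \<le> \<bar>x - y\<bar>"
    and F: "\<And>u. 0 \<le> u \<Longrightarrow> F u \<in> {0..1}" "F 0 = s"
    and deriv: "\<And>u. 0 \<le> u \<Longrightarrow> (F has_real_derivative K * (h (F u) - F u)) (at u)"
    and tree: "branching_tree K h L C \<iota> \<kappa>" and "0 \<le> t"
  shows "expectation (population_weight L C s t) = F t"
proof -
  define q where "q = 1 - exp (- K * t)"
  have q: "0 \<le> q" "q < 1"
    using \<open>K > 0\<close> \<open>0 \<le> t\<close> by (auto simp: q_def)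
  have "1-lipschitz_on {0..1} h"
    using h by (intro lipschitz_onI) (auto simp: dist_real_def)
  then have cont: "continuous_on {0..1} h"
    by (rule lipschitz_on_continuous_on)
  have W01: "expectation (population_weight L C s u) \<in> {0..1}"
    if "branching_tree K h L C \<iota> \<kappa>" for L C \<iota> \<kappa> u
  proof -
    have "population_weight L C s u \<in> borel_measurable M"
      using population_weight_measurable(2)[OF that subset_UNIV] by (rule measurable_gen)
    then have "integrable M (population_weight L C s u)"
      using population_weight_bounds[OF s, of L C u] by (intro integrable_const_bound[where B = 1]) auto
    then show ?thesis
      using population_weight_bounds[OF s, of L C u] by (auto intro!: integral_nonneg integral_le_const)
  qed
  have bound: "\<bar>expectation (population_weight L C s u) - F u\<bar> \<le> q ^ n"
    if "branching_tree K h L C \<iota> \<kappa>" "u \<in> {0..t}" for n L C \<iota> \<kappa> u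
    using that
  proof (induction n arbitrary: L C \<iota> \<kappa> u)
    case 0
    then show ?case
      using W01[OF 0(1), of u] F(1)[of u] by (auto simp: abs_le_iff)
  next
    case (Suc n)
    let ?X = "L []"
    define w where "w k v = expectation (population_weight (\<lambda>v. L (k # v)) (\<lambda>v. C (k # v)) s v)" for k v
    define \<Phi> where "\<Phi> v = expectation (\<lambda>\<omega>. \<Prod>k<C [] \<omega>. w k v)" for v
    have X: "distributed M lborel ?X (exponential_density K)"
      using Suc.prems(1) by (simp add: branching_tree_def)
    then have [measurable]: "?X \<in> borel_measurable M"
      by (auto simp: distributed_def)
    have C: "C [] \<in> measurable M (count_space UNIV)"
      using Suc.prems(1) by (intro measurable_gen[of _ "{\<kappa> []}"]) (simp add: branching_tree_def)
    have pgf: "pgf M (C []) x = h x" if "x \<in> {0..1}" for x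
      using Suc.prems(1) that by (simp add: branching_tree_def)
    have \<Phi>: "\<bar>\<Phi> v - h (F v)\<bar> \<le> q ^ n" if v: "v \<in> {0..t}" for v
    proof -
      \<comment> \<open>the induction hypothesis confines all factors to an interval around F v, cut to the domain of the p.g.f.\<close>
      define a b where "a = max 0 (F v - q ^ n)" and "b = min 1 (F v + q ^ n)"
      have Fv: "F v \<in> {0..1}" and "0 \<le> q ^ n"
        using F(1) v q by auto
      then have ab: "a \<in> {0..1}" "b \<in> {0..1}" "F v - a \<le> q ^ n" "b - F v \<le> q ^ n" "a \<le> F v" "F v \<le> b"
        by (auto simp: a_def b_def)
      have "w k v \<in> {a..b}" for k
        using Suc.IH[OF branching_tree_subtree[OF Suc.prems(1)] v, of k] W01[OF branching_tree_subtree[OF Suc.prems(1)], of k v]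
        by (auto simp: w_def a_def b_def abs_le_iff)
      then have "\<Phi> v \<in> {h a..h b}"
        using expectation_random_prod_bounds[OF C, of "\<lambda>k. w k v" a b] pgf ab unfolding \<Phi>_def by auto
      moreover have "h (F v) - h a \<le> q ^ n" "h b - h (F v) \<le> q ^ n"
        using h[OF Fv ab(1)] h[OF ab(2) Fv] ab by auto
      ultimately show ?thesis by (auto simp: abs_le_iff)
    qed
    have u: "0 \<le> u" "u \<le> t" using Suc.prems(2) by auto
    define P Q where "P \<omega> = (if u < ?X \<omega> then s else \<Phi> (u - ?X \<omega>))"
      and "Q \<omega> = (if u < ?X \<omega> then s else h (F (u - ?X \<omega>)))" for \<omega>
    have E_P: "expectation (population_weight L C s u) = expectation P"
      and [measurable]: "P \<in> borel_measurable M"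
      using population_weight_first_death[OF Suc.prems(1) \<open>K > 0\<close> s u(1)]
      unfolding P_def[abs_def] \<Phi>_def w_def by auto
    have E_Q: "F u = expectation Q" and [measurable]: "Q \<in> borel_measurable M"
      using expectation_first_death[OF X \<open>K > 0\<close> u(1) cont F deriv] unfolding Q_def[abs_def] by auto
    have nonneg: "AE \<omega> in M. 0 \<le> ?X \<omega>"
      using AE_life_times_nonneg[OF Suc.prems(1) \<open>K > 0\<close>] by eventually_elim simp
    have diff: "AE \<omega> in M. \<bar>P \<omega> - Q \<omega>\<bar> \<le> q ^ n * indicator {\<omega>. ?X \<omega> \<le> u} \<omega>"
      using nonneg by eventually_elim (use \<Phi> u q in \<open>auto simp: P_def Q_def indicator_def\<close>)
    have F01: "0 \<le> F v" "F v \<le> 1" if "0 \<le> v" for v using F(1)[OF that] by auto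
    have h01: "h x \<in> {0..1}" if "x \<in> {0..1}" for x
      using pgf_bounds[OF C that] pgf[OF that] by simp
    have "\<bar>Q \<omega>\<bar> \<le> 1" for \<omega>
      using h01[of "F (u - ?X \<omega>)"] F01[of "u - ?X \<omega>"] s by (auto simp: Q_def abs_le_iff)
    then have Q: "integrable M Q"
      by (intro integrable_const_bound[where B = 1]) auto
    have ind: "integrable M (\<lambda>\<omega>. q ^ n * indicator {\<omega>. ?X \<omega> \<le> u} \<omega> :: real)"
      by (intro integrable_const_bound[where B = "q ^ n"]) (use q in \<open>auto simp: indicator_def\<close>)
    have PQ: "integrable M (\<lambda>\<omega>. P \<omega> - Q \<omega>)"
      using diff by (intro Bochner_Integration.integrable_bound[OF ind]) (auto elim!: eventually_mono)
    then have "integrable M P"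
      using Bochner_Integration.integrable_add[OF PQ Q] by simp
    then have "\<bar>expectation P - expectation Q\<bar> = \<bar>expectation (\<lambda>\<omega>. P \<omega> - Q \<omega>)\<bar>"
      using Q by simp
    also have "\<dots> \<le> expectation (\<lambda>\<omega>. \<bar>P \<omega> - Q \<omega>\<bar>)"
      by (rule integral_abs_bound)
    also have "\<dots> \<le> expectation (\<lambda>\<omega>. q ^ n * indicator {\<omega>. ?X \<omega> \<le> u} \<omega>)"
      using diff PQ ind by (intro integral_mono_AE) auto
    also have "\<dots> = q ^ n * \<P>(\<omega> in M. ?X \<omega> \<le> u)"
      by (simp add: Collect_conj_eq Int_commute)
    also have "\<dots> = q ^ n * (1 - exp (- u * K))"
      using exponential_distributedD_le[OF X u(1) \<open>K > 0\<close>] by simp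
    also have "\<dots> \<le> q ^ n * q"
      using q u \<open>K > 0\<close> by (intro mult_left_mono) (auto simp: q_def mult.commute)
    finally show ?case
      by (simp add: E_P E_Q mult.commute)
  qed
  have "(\<lambda>n. q ^ n) \<longlonglongrightarrow> 0"
    using q by (intro LIMSEQ_power_zero) auto
  then have "\<bar>expectation (population_weight L C s t) - F t\<bar> \<le> 0"
    by (rule LIMSEQ_le_const) (use bound[OF tree] \<open>0 \<le> t\<close> in auto)
  then show ?thesis by simp
qed

end


section \<open>The critical offspring law\<close>

text \<open>
  The offspring law is critical: its p.g.f. has derivative 1 at 1.
\<close>

definition critical_pgf :: "real \<Rightarrow> real \<Rightarrow> real" where
  "critical_pgf \<beta> x = x + (1 - x) powr (1 + \<beta>) / (1 + \<beta>)"

text \<open>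
  The solution of the backward Kolmogorov equation with initial value \<open>s\<close>, obtained by separating
  variables: \<open>(1 - F)^(-\<beta>)\<close> grows linearly in time.
\<close>

definition population_pgf :: "real \<Rightarrow> real \<Rightarrow> real \<Rightarrow> real \<Rightarrow> real" where
  "population_pgf A \<beta> s t = 1 - (1 - s) * (1 + (1 - s) powr \<beta> * t / A) powr (- 1 / \<beta>)"

lemma population_pgf_0: "population_pgf A \<beta> s 0 = s"
  by (simp add: population_pgf_def)

lemma population_pgf_bounds:
  assumes "0 < A" "0 < \<beta>" "0 \<le> s" "s \<le> 1" "0 \<le> t"
  shows "s \<le> population_pgf A \<beta> s t" "population_pgf A \<beta> s t \<le> 1"
proof -
  let ?D = "1 + (1 - s) powr \<beta> * t / A"
  have "?D \<ge> 1" using assms by simp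
  then have "?D powr (- 1 / \<beta>) \<le> ?D powr 0"
    using assms by (intro powr_mono) auto
  then have "?D powr (- 1 / \<beta>) \<le> 1"
    using \<open>?D \<ge> 1\<close> by simp
  then have "(1 - s) * ?D powr (- 1 / \<beta>) \<le> (1 - s) * 1"
    using assms by (intro mult_left_mono) auto
  then show "s \<le> population_pgf A \<beta> s t"
    by (simp add: population_pgf_def)
  show "population_pgf A \<beta> s t \<le> 1"
    using assms by (simp add: population_pgf_def)
qed

lemma population_pgf_ODE:
  assumes A: "A = (1 + \<beta>) / (K * \<beta>)" and "0 < K" "0 < \<beta>" "0 \<le> s" "s < 1" "0 \<le> t"
  shows "(population_pgf A \<beta> s has_real_derivative
    K * (critical_pgf \<beta> (population_pgf A \<beta> s t) - population_pgf A \<beta> s t)) (at t)"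
proof -
  define c where "c = (1 - s) powr \<beta> / A"
  have "0 < A" using assms by simp
  define D where "D = 1 + c * t"
  have "D > 0"
    using assms \<open>0 < A\<close> unfolding D_def c_def by (intro add_pos_nonneg) auto
  have F: "population_pgf A \<beta> s = (\<lambda>t. 1 - (1 - s) * (1 + c * t) powr (- 1 / \<beta>))"
    by (simp add: population_pgf_def c_def fun_eq_iff)
  have "((\<lambda>t. 1 - (1 - s) * (1 + c * t) powr (- 1 / \<beta>)) has_real_derivative
      (1 - s) * (1 / \<beta> * c * D powr (- 1 / \<beta> - 1))) (at t)"
    using \<open>D > 0\<close> by (auto intro!: derivative_eq_intros simp: D_def)
  moreover have "(1 - s) * (1 / \<beta> * c * D powr (- 1 / \<beta> - 1)) =
      K * ((1 - s) * D powr (- 1 / \<beta>)) powr (1 + \<beta>) / (1 + \<beta>)"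
  proof -
    have exponent: "- 1 / \<beta> * (1 + \<beta>) = - 1 / \<beta> - 1"
      using assms by (simp add: field_simps)
    have "((1 - s) * D powr (- 1 / \<beta>)) powr (1 + \<beta>) =
        (1 - s) powr (1 + \<beta>) * D powr (- 1 / \<beta> * (1 + \<beta>))"
      using assms \<open>D > 0\<close> by (subst powr_mult) (auto simp: powr_powr)
    also have "\<dots> = (1 - s) * (1 - s) powr \<beta> * D powr (- 1 / \<beta> - 1)"
      using assms unfolding exponent by (simp add: powr_add)
    finally have power: "((1 - s) * D powr (- 1 / \<beta>)) powr (1 + \<beta>) =
        (1 - s) * (1 - s) powr \<beta> * D powr (- 1 / \<beta> - 1)" .
    have coefficient: "1 / \<beta> * c = K * (1 - s) powr \<beta> / (1 + \<beta>)"
      using assms by (simp add: c_def A)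
    show ?thesis
      unfolding power coefficient by simp
  qed
  ultimately show ?thesis
    unfolding F critical_pgf_def D_def by simp
qed

context independent_sources
begin

text \<open>
  Monotonicity comes for free from \<open>critical_pgf \<beta>\<close> being a p.g.f.; the upper bound for the increments
  holds because the second summand of \<open>critical_pgf \<beta>\<close> is decreasing.
\<close>

lemma critical_pgf_nonexpansive:
  assumes C: "C \<in> measurable M (count_space UNIV)"
    and pgf: "\<And>x. x \<in> {0..1} \<Longrightarrow> pgf M C x = critical_pgf \<beta> x" and "0 < \<beta>"
    and xy: "x \<in> {0..1}" "y \<in> {0..1}"
  shows "\<bar>critical_pgf \<beta> x - critical_pgf \<beta> y\<bar> \<le> \<bar>x - y\<bar>"
proof -
  have *: "critical_pgf \<beta> x \<le> critical_pgf \<beta> y \<and> critical_pgf \<beta> y - critical_pgf \<beta> x \<le> y - x"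
    if "0 \<le> x" "x \<le> y" "y \<le> 1" for x y
  proof
    show "critical_pgf \<beta> x \<le> critical_pgf \<beta> y"
      using expectation_random_prod_bounds[OF C, of "\<lambda>_. x" x y] that pgf by auto
    have "(1 - y) powr (1 + \<beta>) \<le> (1 - x) powr (1 + \<beta>)"
      using that \<open>0 < \<beta>\<close> by (intro powr_mono2) auto
    then show "critical_pgf \<beta> y - critical_pgf \<beta> x \<le> y - x"
      using \<open>0 < \<beta>\<close> by (simp add: critical_pgf_def divide_right_mono)
  qed
  show ?thesis
    using *[of x y] *[of y x] xy by (cases "x \<le> y") auto
qed

context
  fixes K \<beta> A :: real and L C \<iota> \<kappa>
  assumes "K > 0" "0 < \<beta>" and A: "A = (1 + \<beta>) / (K * \<beta>)"
    and tree: "branching_tree K (critical_pgf \<beta>) L C \<iota> \<kappa>"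
begin

lemma expectation_critical_population_weight:
  assumes "0 \<le> s" "s < 1" "0 \<le> t"
  shows "expectation (population_weight L C s t) = population_pgf A \<beta> s t"
proof (rule expectation_population_weight[OF \<open>K > 0\<close> _ _ _ _ _ _ tree])
  have "A > 0" using A \<open>K > 0\<close> \<open>0 < \<beta>\<close> by simp
  then show "population_pgf A \<beta> s u \<in> {0..1}" if "0 \<le> u" for u
    using population_pgf_bounds[of A \<beta> s u] that assms \<open>0 < \<beta>\<close> by auto
  show "\<bar>critical_pgf \<beta> x - critical_pgf \<beta> y\<bar> \<le> \<bar>x - y\<bar>" if "x \<in> {0..1}" "y \<in> {0..1}" for x y
  proof (rule critical_pgf_nonexpansive[OF _ _ \<open>0 < \<beta>\<close> that])
    show "C [] \<in> measurable M (count_space UNIV)"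
      using tree by (intro measurable_gen[of _ "{\<kappa> []}"]) (simp add: branching_tree_def)
    show "pgf M (C []) x = critical_pgf \<beta> x" if "x \<in> {0..1}" for x
      using tree that by (simp add: branching_tree_def)
  qed
qed (use assms \<open>K > 0\<close> \<open>0 < \<beta>\<close> in \<open>auto intro!: population_pgf_ODE[OF A] simp: population_pgf_0\<close>)

text \<open>
  The finiteness probability dominates the expected weight \<open>F(t, s) \<ge> s\<close> for every \<open>s < 1\<close>, hence is 1.
\<close>

lemma AE_finite_alive:
  assumes "0 \<le> t"
  shows "AE \<omega> in M. finite (alive L C t \<omega>)"
proof -
  have fin: "Measurable.pred M (\<lambda>\<omega>. finite (alive L C t \<omega>))"
    using population_weight_measurable(5)[OF tree subset_UNIV] by (rule measurable_gen)
  have "A > 0" using A \<open>K > 0\<close> \<open>0 < \<beta>\<close> by simp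
  let ?p = "\<P>(\<omega> in M. finite (alive L C t \<omega>))"
  have le: "s \<le> ?p" if s: "0 < s" "s < 1" for s
  proof -
    have "s \<le> population_pgf A \<beta> s t"
      using population_pgf_bounds[of A \<beta> s t] that assms \<open>A > 0\<close> \<open>0 < \<beta>\<close> by auto
    also have "\<dots> = expectation (population_weight L C s t)"
      using expectation_critical_population_weight[of s t] that assms by simp
    also have "\<dots> \<le> expectation (indicator {\<omega>. finite (alive L C t \<omega>)})"
    proof (rule integral_mono)
      have "population_weight L C s t \<in> borel_measurable M"
        using population_weight_measurable(2)[OF tree subset_UNIV] by (rule measurable_gen)
      then show "integrable M (population_weight L C s t)"
        using population_weight_bounds[of s L C t] s by (intro integrable_const_bound[where B = 1]) auto
      show "integrable M (indicat_real {\<omega>. finite (alive L C t \<omega>)})"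
        using fin by (intro integrable_const_bound[where B = 1]) auto
    qed (use s in \<open>auto simp: population_weight_def indicator_def power_le_one\<close>)
    also have "\<dots> = ?p"
      by (simp add: Collect_conj_eq Int_commute)
    finally show ?thesis .
  qed
  have "1 \<le> ?p"
    by (rule dense_le_bounded[of 0]) (use le in auto)
  then have "?p = 1" by (simp add: antisym)
  then show ?thesis
    using fin by (subst (asm) prob_Collect_eq_1) auto
qed

theorem expectation_power_branching_process:
  assumes "0 \<le> s" "s < 1" "0 \<le> t"
  shows "expectation (\<lambda>\<omega>. s ^ branching_process L C t \<omega>) = population_pgf A \<beta> s t"
proof -
  have "expectation (\<lambda>\<omega>. s ^ branching_process L C t \<omega>) = expectation (population_weight L C s t)"
  proof (rule integral_cong_AE)
    have [measurable]: "branching_process L C t \<in> measurable M (count_space UNIV)"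
      using population_weight_measurable(3)[OF tree subset_UNIV] by (rule measurable_gen)
    show "(\<lambda>\<omega>. s ^ branching_process L C t \<omega>) \<in> borel_measurable M"
      by measurable
    show "population_weight L C s t \<in> borel_measurable M"
      using population_weight_measurable(2)[OF tree subset_UNIV] by (rule measurable_gen)
    show "AE \<omega> in M. s ^ branching_process L C t \<omega> = population_weight L C s t \<omega>"
      using AE_finite_alive[OF \<open>0 \<le> t\<close>] by eventually_elim (simp add: population_weight_def)
  qed
  then show ?thesis
    using expectation_critical_population_weight[OF assms] by simp
qed

end

end


section \<open>Products over the jumps of a Poisson process\<close>

lemma Riemann_sum_tendsto:
  fixes f :: "real \<Rightarrow> real"
  assumes f: "continuous_on {0..t} f" and "0 < t"
  shows "(\<lambda>m. \<Sum>k<m. t / real m * f (t * real k / real m)) \<longlonglongrightarrow> integral {0..t} f"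
proof (rule LIMSEQ_I)
  fix e :: real assume "0 < e"
  obtain G where G: "\<And>x. x \<in> {0..t} \<Longrightarrow> (G has_vector_derivative f x) (at x within {0..t})"
    using antiderivative_continuous[OF f] by blast
  have "uniformly_continuous_on {0..t} f"
    using f by (intro compact_uniformly_continuous) auto
  moreover have "0 < e / (2 * t)" using \<open>0 < e\<close> \<open>0 < t\<close> by simp
  ultimately obtain d where d: "0 < d"
    "\<And>x y. x \<in> {0..t} \<Longrightarrow> y \<in> {0..t} \<Longrightarrow> dist y x < d \<Longrightarrow> dist (f y) (f x) < e / (2 * t)"
    unfolding uniformly_continuous_on_def by metis
  obtain m0 :: nat where m0: "t / d < m0"
    using reals_Archimedean2 by blast
  show "\<exists>no. \<forall>m\<ge>no. norm ((\<Sum>k<m. t / real m * f (t * real k / real m)) - integral {0..t} f) < e"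
  proof (intro exI[of _ m0] allI impI)
    fix m :: nat assume "m0 \<le> m"
    have m: "0 < m" "t / m < d"
    proof -
      have "t / d < m" using m0 \<open>m0 \<le> m\<close> by (meson less_le_trans of_nat_le_iff)
      moreover have "0 < t / d" using \<open>0 < t\<close> d(1) by simp
      ultimately have "(0::real) < m" by linarith
      then show "0 < m" by simp
      with \<open>t / d < m\<close> d(1) show "t / m < d" by (simp add: field_simps)
    qed
    define r where "r k = t * real k / m" for k
    have r: "r k \<in> {0..t}" if "k \<le> m" for k
      using that \<open>0 < t\<close> m by (auto simp: r_def field_simps)
    have r_Suc: "r (Suc k) - r k = t / m" for k
      by (simp add: r_def algebra_simps add_divide_distrib)
    have cell: "\<bar>t / m * f (r k) - (G (r (Suc k)) - G (r k))\<bar> \<le> e / (2 * m)" if "k < m" for k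
    proof -
      have "r k < r (Suc k)" using r_Suc[of k] \<open>0 < t\<close> m by (simp add: algebra_simps)
      moreover have "(G has_derivative (\<lambda>h. h * f x)) (at x within {r k..r (Suc k)})"
        if "r k \<le> x" "x \<le> r (Suc k)" for x
      proof -
        have sub: "{r k..r (Suc k)} \<subseteq> {0..t}"
          using r[of k] r[of "Suc k"] \<open>k < m\<close> by auto
        then have "(G has_vector_derivative f x) (at x within {r k..r (Suc k)})"
          using that by (intro has_vector_derivative_within_subset[OF G]) auto
        then show ?thesis by (simp add: has_vector_derivative_def)
      qed
      ultimately obtain x where x: "x \<in> {r k<..<r (Suc k)}"
          "G (r (Suc k)) - G (r k) = (r (Suc k) - r k) * f x"
        using mvt_simple[of "r k" "r (Suc k)" G "\<lambda>x h. h * f x"] by auto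
      have "dist x (r k) < d"
        using x(1) m(2) r_Suc[of k] by (auto simp: dist_real_def)
      then have "\<bar>f x - f (r k)\<bar> < e / (2 * t)"
        using d(2)[of "r k" x] x(1) r[of k] r[of "Suc k"] \<open>k < m\<close> by (auto simp: dist_real_def)
      then have "t / m * \<bar>f (r k) - f x\<bar> \<le> t / m * (e / (2 * t))"
        using \<open>0 < t\<close> by (intro mult_left_mono) auto
      also have "\<dots> = e / (2 * m)"
        using \<open>0 < t\<close> by (simp add: field_simps)
      finally show ?thesis
        using \<open>0 < t\<close> unfolding x(2) r_Suc right_diff_distrib[symmetric] abs_mult by simp
    qed
    have "integral {0..t} f = G t - G 0"
      using G \<open>0 < t\<close> by (intro integral_unique fundamental_theorem_of_calculus) auto
    also have "\<dots> = (\<Sum>k<m. G (r (Suc k)) - G (r k))"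
      using m(1) sum_lessThan_telescope[of "\<lambda>k. G (r k)" m] by (simp add: r_def)
    finally have "(\<Sum>k<m. t / m * f (r k)) - integral {0..t} f =
        (\<Sum>k<m. t / m * f (r k) - (G (r (Suc k)) - G (r k)))"
      by (simp add: sum_subtractf)
    also have "\<bar>\<dots>\<bar> \<le> (\<Sum>k<m. e / (2 * m))"
      using cell by (intro order_trans[OF sum_abs] sum_mono) auto
    also have "\<dots> < e"
      using m(1) \<open>0 < e\<close> by simp
    finally show "norm ((\<Sum>k<m. t / real m * f (t * real k / real m)) - integral {0..t} f) < e"
      by (simp add: r_def)
  qed
qed

lemma expectation_power_poisson_pmf:
  assumes "0 < rate" "0 \<le> x" "x \<le> 1"
  shows "measure_pmf.expectation (poisson_pmf rate) (\<lambda>n. x ^ n) = exp (- rate * (1 - x))"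
proof -
  have sums: "(\<lambda>n. pmf (poisson_pmf rate) n * x ^ n) sums (exp (rate * x) * exp (- rate))"
    using sums_mult2[OF exp_converges[of "rate * x"], of "exp (- rate)"] assms
    by (simp add: power_mult_distrib field_simps)
  have int: "integrable (count_space UNIV) (\<lambda>n. pmf (poisson_pmf rate) n * x ^ n)"
    using sums assms by (simp add: integrable_count_space_nat_iff sums_iff abs_mult)
  have "measure_pmf.expectation (poisson_pmf rate) (\<lambda>n. x ^ n) =
      (\<integral>n. pmf (poisson_pmf rate) n * x ^ n \<partial>count_space UNIV)"
    by (subst measure_pmf_eq_density) (simp add: integral_density)
  also have "\<dots> = exp (rate * x) * exp (- rate)"
    using sums by (simp add: integral_count_space_nat[OF int] sums_iff)
  also have "\<dots> = exp (- rate * (1 - x))"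
    by (simp add: exp_add[symmetric] algebra_simps)
  finally show ?thesis .
qed

text \<open>
  A product over grid cells, each factor raised to the number of jumps in its cell, is a product over
  the jumps.  The \<open>LEAST\<close> expression is the cell that contains the \<open>i\<close>-th jump.
\<close>

lemma prod_power_increments:
  fixes f :: "nat \<Rightarrow> 'b::comm_monoid_mult" and a :: "nat \<Rightarrow> nat"
  assumes "mono a" "a 0 = 0"
  shows "(\<Prod>k<m. f k ^ (a (Suc k) - a k)) = (\<Prod>i<a m. f (LEAST k. i < a (Suc k)))"
proof (induction m)
  case (Suc m)
  have "(LEAST k. i < a (Suc k)) = m" if "a m \<le> i" "i < a (Suc m)" for i
  proof (rule Least_equality)
    show "m \<le> k" if "i < a (Suc k)" for k
      using monoD[OF \<open>mono a\<close>, of "Suc k" m] that \<open>a m \<le> i\<close> by (cases "m \<le> k") auto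
  qed fact
  then have "(\<Prod>i = a m..<a (Suc m). f (LEAST k. i < a (Suc k))) = f m ^ (a (Suc m) - a m)"
    by simp
  moreover have "(\<Prod>i<a (Suc m). f (LEAST k. i < a (Suc k))) =
      (\<Prod>i<a m. f (LEAST k. i < a (Suc k))) * (\<Prod>i = a m..<a (Suc m). f (LEAST k. i < a (Suc k)))"
    using monoD[OF \<open>mono a\<close>, of m "Suc m"]
    by (subst prod.union_disjoint[symmetric]) (auto intro!: prod.cong)
  ultimately show ?case
    using Suc by simp
qed (simp add: assms)

lemma jump_time_bounds:
  assumes "0 \<le> r" "0 \<le> s" and "i < N r \<omega>" and "N s \<omega> \<le> i"
    and mono: "mono_on {0..} (\<lambda>t. N t \<omega>)"
  shows "s \<le> jump_time N i \<omega>" "jump_time N i \<omega> \<le> r"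
proof -
  have "s \<le> x" if "0 \<le> x" "i < N x \<omega>" for x
    using mono_onD[OF mono, of x s] that \<open>0 \<le> s\<close> \<open>N s \<omega> \<le> i\<close> by (cases "s \<le> x") auto
  then show "s \<le> jump_time N i \<omega>"
    unfolding jump_time_def using assms by (intro cInf_greatest) auto
  show "jump_time N i \<omega> \<le> r"
    unfolding jump_time_def using assms by (intro cInf_lower bdd_belowI[where m = 0]) auto
qed

text \<open>
  The probability generating functional of the Poisson process.  On the grid \<open>t k / m\<close>, the product
  with each jump rounded down to the grid involves only the increments, which are independent and
  Poisson.  As \<open>m\<close> grows, the rounded jumps converge to the jumps, and dominated convergence applies
  since all products lie in \<open>[0, 1]\<close>.
\<close>

theorem (in prob_space) expectation_prod_poisson_process:
  assumes N: "poisson_process M \<theta> N" and "0 < \<theta>" "0 < t"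
    and cont: "continuous_on {0..t} \<phi>" and \<phi>: "\<And>x. x \<in> {0..t} \<Longrightarrow> \<phi> x \<in> {0..1}"
  shows "expectation (\<lambda>\<omega>. \<Prod>i<N t \<omega>. \<phi> (jump_time N i \<omega>)) = exp (- \<theta> * integral {0..t} (\<lambda>x. 1 - \<phi> x))"
proof -
  have N_meas: "N u \<in> measurable M (count_space UNIV)" if "0 \<le> u" for u
    using N that by (auto simp: poisson_process_def)
  have N_0: "N 0 \<omega> = 0" and N_mono: "mono_on {0..} (\<lambda>t. N t \<omega>)" if "\<omega> \<in> space M" for \<omega>
    using N that by (auto simp: poisson_process_def)
  define r where "r m k = t * real k / real m" for m k
  define P where "P m \<omega> = (\<Prod>k<m. \<phi> (r m k) ^ (N (r m (Suc k)) \<omega> - N (r m k) \<omega>))" for m \<omega>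
  have r_nonneg: "0 \<le> r m k" for m k
    using \<open>0 < t\<close> by (simp add: r_def)
  have r_le: "r m k \<in> {0..t}" if "k \<le> m" for m k
    using that \<open>0 < t\<close> by (cases "m = 0") (auto simp: r_def field_simps)
  have N_r[measurable]: "N (r m k) \<in> measurable M (count_space UNIV)" for m k
    by (rule N_meas[OF r_nonneg])
  have incseq_r: "incseq (r m)" for m
    using \<open>0 < t\<close> by (intro incseq_SucI) (simp add: r_def divide_right_mono)
  have \<phi>_r: "0 \<le> \<phi> (r m k)" "\<phi> (r m k) \<le> 1" if "k < m" for m k
    using \<phi>[OF r_le[of k m]] that by auto
  have E_P: "expectation (P m) = exp (- \<theta> * (\<Sum>k<m. t / m * (1 - \<phi> (r m k))))" if "0 < m" for m
  proof -
    have indep: "indep_vars (\<lambda>_. count_space UNIV) (\<lambda>k \<omega>. N (r m (Suc k)) \<omega> - N (r m k) \<omega>) {..<m}"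
      using N incseq_r[of m] r_nonneg[of m 0] by (simp add: poisson_process_def)
    have "expectation (P m) = (\<Prod>k<m. expectation (\<lambda>\<omega>. \<phi> (r m k) ^ (N (r m (Suc k)) \<omega> - N (r m k) \<omega>)))"
      unfolding P_def
    proof (rule indep_vars_lebesgue_integral)
      show "indep_vars (\<lambda>_. borel) (\<lambda>k \<omega>. \<phi> (r m k) ^ (N (r m (Suc k)) \<omega> - N (r m k) \<omega>)) {..<m}"
        by (rule indep_vars_compose2[OF indep]) simp
      show "integrable M (\<lambda>\<omega>. \<phi> (r m k) ^ (N (r m (Suc k)) \<omega> - N (r m k) \<omega>))" if "k \<in> {..<m}" for k
        using that \<phi>_r by (intro integrable_const_bound[where B = 1]) (auto simp: power_le_one)
    qed simp
    also have "\<dots> = (\<Prod>k<m. exp (- \<theta> * (t / m * (1 - \<phi> (r m k)))))"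
    proof (rule prod.cong[OF refl])
      fix k assume k: "k \<in> {..<m}"
      have less: "r m k < r m (Suc k)"
        using \<open>0 < m\<close> \<open>0 < t\<close> by (simp add: r_def divide_strict_right_mono)
      have diff: "r m (Suc k) - r m k = t / m"
        by (simp add: r_def add_divide_distrib algebra_simps)
      have "distr M (count_space UNIV) (\<lambda>\<omega>. N (r m (Suc k)) \<omega> - N (r m k) \<omega>) =
          measure_pmf (poisson_pmf (\<theta> * (t / m)))"
        using N less r_nonneg[of m k] diff by (simp add: poisson_process_def)
      moreover have "(\<lambda>\<omega>. N (r m (Suc k)) \<omega> - N (r m k) \<omega>) \<in> measurable M (count_space UNIV)"
        by measurable
      ultimately have "expectation (\<lambda>\<omega>. \<phi> (r m k) ^ (N (r m (Suc k)) \<omega> - N (r m k) \<omega>)) =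
          measure_pmf.expectation (poisson_pmf (\<theta> * (t / m))) (\<lambda>n. \<phi> (r m k) ^ n)"
        by (subst integral_distr[symmetric, where N = "count_space UNIV" and f = "\<lambda>n. \<phi> (r m k) ^ n"]) auto
      also have "\<dots> = exp (- \<theta> * (t / m * (1 - \<phi> (r m k))))"
        using \<open>0 < \<theta>\<close> \<open>0 < t\<close> \<open>0 < m\<close> \<phi>_r k by (subst expectation_power_poisson_pmf) (auto simp: mult.assoc)
      finally show "expectation (\<lambda>\<omega>. \<phi> (r m k) ^ (N (r m (Suc k)) \<omega> - N (r m k) \<omega>)) =
          exp (- \<theta> * (t / m * (1 - \<phi> (r m k))))" .
    qed
    also have "\<dots> = exp (- \<theta> * (\<Sum>k<m. t / m * (1 - \<phi> (r m k))))"
      by (simp add: exp_sum[symmetric] sum_distrib_left)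
    finally show ?thesis .
  qed
  have P_lim: "(\<lambda>m. P m \<omega>) \<longlonglongrightarrow> (\<Prod>i<N t \<omega>. \<phi> (jump_time N i \<omega>))" if \<omega>: "\<omega> \<in> space M" for \<omega>
  proof -
    define k where "k m i = (LEAST k. i < N (r m (Suc k)) \<omega>)" for m i
    have mono_a: "mono (\<lambda>k. N (r m k) \<omega>)" for m
      using mono_onD[OF N_mono[OF \<omega>]] r_nonneg incseq_r[of m] by (auto simp: incseq_def intro!: monoI)
    have P_eq: "P m \<omega> = (\<Prod>i<N t \<omega>. \<phi> (r m (k m i)))" if "0 < m" for m
      using prod_power_increments[OF mono_a[of m], of "\<lambda>k. \<phi> (r m k)" m] N_0[OF \<omega>] that
      by (simp add: P_def k_def r_def)
    \<comment> \<open>the i-th jump and its rounded version lie in the same grid cell\<close>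
    have near: "k m i < m \<and> \<bar>r m (k m i) - jump_time N i \<omega>\<bar> \<le> t / m" if "0 < m" "i < N t \<omega>" for m i
    proof -
      have "i < N (r m (Suc (m - 1))) \<omega>"
        using that by (simp add: r_def)
      then have k: "i < N (r m (Suc (k m i))) \<omega>" "k m i \<le> m - 1"
        unfolding k_def by (auto intro: LeastI Least_le)
      have "N (r m (k m i)) \<omega> \<le> i"
      proof (cases "k m i")
        case 0
        then show ?thesis using N_0[OF \<omega>] by (simp add: r_def)
      next
        case (Suc j)
        then have "\<not> i < N (r m (Suc j)) \<omega>"
          using not_less_Least[of j "\<lambda>k. i < N (r m (Suc k)) \<omega>"] by (simp add: k_def)
        then show ?thesis using Suc by simp
      qed
      then have "r m (k m i) \<le> jump_time N i \<omega>" "jump_time N i \<omega> \<le> r m (Suc (k m i))"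
        using jump_time_bounds[of "r m (Suc (k m i))" "r m (k m i)" i N \<omega>] r_nonneg k(1) N_mono[OF \<omega>] by auto
      moreover have "r m (Suc (k m i)) = r m (k m i) + t / m"
        by (simp add: r_def add_divide_distrib algebra_simps)
      ultimately show ?thesis
        using k(2) that by auto
    qed
    have "(\<lambda>m. \<phi> (r m (k m i))) \<longlonglongrightarrow> \<phi> (jump_time N i \<omega>)" if i: "i < N t \<omega>" for i
    proof (rule continuous_on_tendsto_compose[OF cont])
      have "(\<lambda>m. r m (k m i) - jump_time N i \<omega>) \<longlonglongrightarrow> 0"
      proof (rule Lim_null_comparison)
        show "\<forall>\<^sub>F m in sequentially. norm (r m (k m i) - jump_time N i \<omega>) \<le> t / m"
          using eventually_gt_at_top[of 0] by eventually_elim (use near i in auto)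
        show "(\<lambda>m. t / real m) \<longlonglongrightarrow> 0"
          by (rule lim_const_over_n)
      qed
      then show "(\<lambda>m. r m (k m i)) \<longlonglongrightarrow> jump_time N i \<omega>"
        by (simp add: LIM_zero_iff)
      show "jump_time N i \<omega> \<in> {0..t}"
        using jump_time_bounds[of t 0 i N \<omega>] i N_0[OF \<omega>] N_mono[OF \<omega>] \<open>0 < t\<close> by auto
      show "\<forall>\<^sub>F m in sequentially. r m (k m i) \<in> {0..t}"
        using eventually_gt_at_top[of 0]
        by eventually_elim (use near i r_le in \<open>simp del: atLeastAtMost_iff add: less_imp_le\<close>)
    qed
    then have "(\<lambda>m. \<Prod>i<N t \<omega>. \<phi> (r m (k m i))) \<longlonglongrightarrow> (\<Prod>i<N t \<omega>. \<phi> (jump_time N i \<omega>))"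
      by (intro tendsto_prod) auto
    moreover have "\<forall>\<^sub>F m in sequentially. (\<Prod>i<N t \<omega>. \<phi> (r m (k m i))) = P m \<omega>"
      using eventually_gt_at_top[of 0] by eventually_elim (simp add: P_eq)
    ultimately show ?thesis
      by (rule Lim_transform_eventually)
  qed
  have P_meas: "P m \<in> borel_measurable M" for m
    unfolding P_def
    by measurable
  have P_bound: "norm (P m \<omega>) \<le> 1" for m \<omega>
    unfolding P_def using \<phi>_r by (auto simp: abs_prod intro!: prod_le_1 power_le_one)
  have lim_meas: "(\<lambda>\<omega>. \<Prod>i<N t \<omega>. \<phi> (jump_time N i \<omega>)) \<in> borel_measurable M"
    using P_lim P_meas by (rule borel_measurable_LIMSEQ_real)
  have "(\<lambda>m. expectation (P m)) \<longlonglongrightarrow> expectation (\<lambda>\<omega>. \<Prod>i<N t \<omega>. \<phi> (jump_time N i \<omega>))"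
    by (rule integral_dominated_convergence[where w = "\<lambda>_. 1"])
       (use lim_meas P_meas P_lim P_bound in auto)
  moreover have "(\<lambda>m. expectation (P m)) \<longlonglongrightarrow> exp (- \<theta> * integral {0..t} (\<lambda>x. 1 - \<phi> x))"
  proof -
    have "(\<lambda>m. \<Sum>k<m. t / m * (1 - \<phi> (r m k))) \<longlonglongrightarrow> integral {0..t} (\<lambda>x. 1 - \<phi> x)"
      unfolding r_def using \<open>0 < t\<close>
      by (intro Riemann_sum_tendsto[where f = "\<lambda>x. 1 - \<phi> x"] continuous_intros cont)
    then have "(\<lambda>m. exp (- \<theta> * (\<Sum>k<m. t / m * (1 - \<phi> (r m k))))) \<longlonglongrightarrow>
        exp (- \<theta> * integral {0..t} (\<lambda>x. 1 - \<phi> x))"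
      by (intro tendsto_intros)
    moreover have "\<forall>\<^sub>F m in sequentially. exp (- \<theta> * (\<Sum>k<m. t / m * (1 - \<phi> (r m k)))) = expectation (P m)"
      using eventually_gt_at_top[of 0] by eventually_elim (simp add: E_P)
    ultimately show ?thesis
      by (rule Lim_transform_eventually)
  qed
  ultimately show ?thesis
    by (rule LIMSEQ_unique)
qed


section \<open>Branching with immigration\<close>

lemma integral_reflect_Icc:
  fixes f :: "real \<Rightarrow> real"
  assumes f: "continuous_on {0..t} f" and "0 \<le> t"
  shows "integral {0..t} (\<lambda>x. f (t - x)) = integral {0..t} f"
proof -
  obtain G where G: "\<And>x. x \<in> {0..t} \<Longrightarrow> (G has_vector_derivative f x) (at x within {0..t})"
    using antiderivative_continuous[OF f] by blast
  have "((\<lambda>x. - G (t - x)) has_vector_derivative f (t - x)) (at x within {0..t})" if "x \<in> {0..t}" for x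
  proof -
    have "(-) t ` {0..t} = {0..t}"
      by (auto simp: image_iff intro!: bexI[of _ "t - _"])
    then have "(G has_vector_derivative f (t - x)) (at (t - x) within (-) t ` {0..t})"
      using G[of "t - x"] that by simp
    then have "(G \<circ> (-) t has_vector_derivative (- 1) *\<^sub>R f (t - x)) (at x within {0..t})"
      by (intro vector_diff_chain_within) (auto intro!: derivative_eq_intros)
    from has_vector_derivative_minus[OF this] show ?thesis
      by (simp add: o_def)
  qed
  then have "((\<lambda>x. f (t - x)) has_integral - G (t - t) - (- G (t - 0))) {0..t}"
    using \<open>0 \<le> t\<close> by (intro fundamental_theorem_of_calculus) auto
  moreover have "(f has_integral G t - G 0) {0..t}"
    using G \<open>0 \<le> t\<close> by (intro fundamental_theorem_of_calculus) auto
  ultimately show ?thesis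
    by (simp add: integral_unique)
qed

lemma continuous_on_population_pgf:
  assumes "0 < A" "0 < \<beta>" "0 \<le> s" "s < 1"
  shows "continuous_on {0..} (population_pgf A \<beta> s)"
proof -
  have "1 + (1 - s) powr \<beta> * t / A \<noteq> 0" if "0 \<le> t" for t
    using assms that by (intro less_imp_neq[THEN not_sym] add_pos_nonneg) auto
  then show ?thesis
    unfolding population_pgf_def using assms by (intro continuous_intros) auto
qed

lemma continuous_on_survival_powr:
  assumes "0 < A" "0 < \<beta>" "0 \<le> s" "s < 1" "0 < \<gamma>"
  shows "continuous_on {0..} (\<lambda>u. (1 - population_pgf A \<beta> s u) powr \<gamma>)"
  using assms population_pgf_bounds[of A \<beta> s]
  by (intro continuous_on_powr' continuous_intros continuous_on_population_pgf) auto

locale branching_immigration = prob_space M for M :: "'a measure" +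
  fixes K \<theta> \<beta> \<gamma> A :: real
    and N :: "real \<Rightarrow> 'a \<Rightarrow> nat"
    and I :: "nat \<Rightarrow> 'a \<Rightarrow> nat"
    and L :: "nat \<Rightarrow> nat \<Rightarrow> nat list \<Rightarrow> 'a \<Rightarrow> real"
    and C :: "nat \<Rightarrow> nat \<Rightarrow> nat list \<Rightarrow> 'a \<Rightarrow> nat"
  assumes pos: "K > 0" "\<theta> > 0" "0 < \<beta>" "0 < \<gamma>"
    and A: "A = (1 + \<beta>) / (K * \<beta>)"
    and flow: "poisson_process M \<theta> N"
    and group_size: "\<And>i. I i \<in> measurable M (count_space UNIV)"
      "\<And>i s. \<bar>s\<bar> \<le> 1 \<Longrightarrow> pgf M (I i) s = 1 - (1 - s) powr \<gamma>"
    and life_time: "\<And>i j u. distributed M lborel (L i j u) (exponential_density K)"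
    and offspring: "\<And>i j u. C i j u \<in> measurable M (count_space UNIV)"
      "\<And>i j u s. \<bar>s\<bar> \<le> 1 \<Longrightarrow> pgf M (C i j u) s = s + (1 - s) powr (1 + \<beta>) / (1 + \<beta>)"
    and independent: "indep_sets (source_events M N I L C) UNIV"
begin

lemma Int_stable_source_events: "Int_stable (source_events M N I L C x)"
proof (cases x)
  case Flow
  have "(\<Union>t\<in>{0..}. sets (vimage_algebra (space M) (N t) (count_space UNIV))) \<subseteq> Pow (space M)"
    using sets.sets_into_space[of _ "vimage_algebra (space M) (N _) (count_space UNIV)"] by fastforce
  then have "source_events M N I L C x =
      sets (sigma (space M) (\<Union>t\<in>{0..}. sets (vimage_algebra (space M) (N t) (count_space UNIV))))"
    using Flow by simp
  then show ?thesis
    by (auto simp: Int_stable_def)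
qed (auto simp: Int_stable_def)

sublocale independent_sources M "source_events M N I L C"
  by unfold_locales (fact independent Int_stable_source_events)+

lemma A_pos: "A > 0"
  using pos A by simp

lemma flow_measurable [measurable]:
  "0 \<le> t \<Longrightarrow> N t \<in> measurable (gen {Flow}) (count_space UNIV)"
  by (rule measurable_gen_singleI) (auto intro!: sigma_sets.Basic in_vimage_algebra)

lemma group_size_measurable: "I i \<in> measurable (gen {Group_Size i}) (count_space UNIV)"
  by (rule measurable_gen_singleI) (auto intro!: in_vimage_algebra)

lemma branching_tree_family: "branching_tree K (critical_pgf \<beta>) (L i j) (C i j) (Life_Time i j) (Offspring i j)"
  unfolding branching_tree_def using life_time offspring(2)
  by (auto simp: inj_def critical_pgf_def intro!: measurable_gen_singleI in_vimage_algebra)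

text \<open>
  The infimum over real times is below \<open>x\<close> iff the flow exceeds \<open>i\<close> at some rational time below \<open>x\<close>,
  by monotonicity of the paths.  The value is set to 0 when the jump has not happened by time \<open>t\<close>,
  because the infimum of an empty set is unspecified.
\<close>

lemma jump_time_measurable:
  assumes "0 \<le> t"
  shows "(\<lambda>\<omega>. if i < N t \<omega> then jump_time N i \<omega> else 0) \<in> borel_measurable (gen {Flow})"
proof -
  have N_gt: "{\<omega> \<in> space M. i < N q \<omega>} \<in> sets (gen {Flow})" if "0 \<le> q" for q
    using measurable_sets[OF flow_measurable[OF that], of "{i<..}"]
    by (simp add: vimage_def Int_def conj_commute)
  have "{\<omega> \<in> space M. i < N t \<omega> \<and> jump_time N i \<omega> < x} \<in> sets (gen {Flow})" for x
  proof -
    have "i < N t \<omega> \<and> jump_time N i \<omega> < x \<longleftrightarrow> i < N t \<omega> \<and> (\<exists>q\<in>{q\<in>\<rat>. 0 \<le> q \<and> q < x}. i < N q \<omega>)"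
      if \<omega>: "\<omega> \<in> space M" for \<omega>
    proof -
      have mono: "mono_on {0..} (\<lambda>t. N t \<omega>)"
        using flow \<omega> by (simp add: poisson_process_def)
      have "\<exists>q\<in>{q\<in>\<rat>. 0 \<le> q \<and> q < x}. i < N q \<omega>" if jump: "i < N t \<omega>" "jump_time N i \<omega> < x"
      proof -
        have "{t. 0 \<le> t \<and> i < N t \<omega>} \<noteq> {}"
          using jump(1) assms by auto
        then obtain r where r: "0 \<le> r" "i < N r \<omega>" "r < x"
          using cInf_lessD jump(2) unfolding jump_time_def by (metis (mono_tags, lifting) mem_Collect_eq)
        obtain q where q: "q \<in> \<rat>" "r < q" "q < x"
          using Rats_dense_in_real[OF r(3)] by blast
        have "N r \<omega> \<le> N q \<omega>"
          using mono_onD[OF mono, of r q] r q by auto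
        then show ?thesis
          using r q by (intro bexI[of _ q]) auto
      qed
      moreover have "jump_time N i \<omega> < x" if "0 \<le> q" "q < x" "i < N q \<omega>" for q
        unfolding jump_time_def using that
        by (intro le_less_trans[OF cInf_lower]) (auto intro!: bdd_belowI[where m = 0])
      ultimately show ?thesis by auto
    qed
    then have "{\<omega> \<in> space M. i < N t \<omega> \<and> jump_time N i \<omega> < x} =
        {\<omega> \<in> space M. i < N t \<omega>} \<inter> (\<Union>q\<in>{q\<in>\<rat>. 0 \<le> q \<and> q < x}. {\<omega> \<in> space M. i < N q \<omega>})"
      by auto
    also have "\<dots> \<in> sets (gen {Flow})"
    proof (intro sets.Int sets.countable_UN')
      show "countable {q::real. q \<in> \<rat> \<and> 0 \<le> q \<and> q < x}"
        by (rule countable_subset[OF _ countable_rat]) auto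
    qed (use assms N_gt in auto)
    finally show ?thesis .
  qed
  moreover have "{\<omega> \<in> space M. \<not> i < N t \<omega>} \<in> sets (gen {Flow})"
  proof -
    have "{\<omega> \<in> space M. \<not> i < N t \<omega>} = space (gen {Flow}) - {\<omega> \<in> space M. i < N t \<omega>}"
      by auto
    then show ?thesis
      using N_gt[OF assms] by (metis sets.compl_sets)
  qed
  ultimately have "{\<omega> \<in> space M. i < N t \<omega> \<and> jump_time N i \<omega> < x} \<union>
      (if 0 < x then {\<omega> \<in> space M. \<not> i < N t \<omega>} else {}) \<in> sets (gen {Flow})" for x
    by auto
  moreover have "{\<omega> \<in> space (gen {Flow}). (if i < N t \<omega> then jump_time N i \<omega> else 0) < x} =
      {\<omega> \<in> space M. i < N t \<omega> \<and> jump_time N i \<omega> < x} \<union>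
      (if 0 < x then {\<omega> \<in> space M. \<not> i < N t \<omega>} else {})" for x
    by auto
  ultimately show ?thesis
    unfolding borel_measurable_iff_less by simp
qed

definition family_sources :: "nat \<Rightarrow> nat \<Rightarrow> source set" where
  "family_sources i j = range (Life_Time i j) \<union> range (Offspring i j)"

definition group_sources :: "nat \<Rightarrow> source set" where
  "group_sources i = insert (Group_Size i) (\<Union>j. family_sources i j)"

text \<open>
  The contribution to \<open>s\<^sup>Y\<close> of the \<open>i\<close>-th group at age \<open>u\<close>.
\<close>

definition group_weight :: "real \<Rightarrow> nat \<Rightarrow> real \<Rightarrow> 'a \<Rightarrow> real" where
  "group_weight s i u \<omega> = (\<Prod>j<I i \<omega>. s ^ branching_process (L i j) (C i j) u \<omega>)"

lemma group_weight_measurable: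
  assumes "group_sources i \<subseteq> J"
  shows "(\<lambda>x. group_weight s i (fst x) (snd x)) \<in> borel_measurable (borel \<Otimes>\<^sub>M gen J)"
    and "group_weight s i u \<in> borel_measurable (gen J)"
proof -
  have [measurable]: "I i \<in> measurable (gen J) (count_space UNIV)"
    using group_size_measurable by (rule measurable_gen_mono) (use assms in \<open>auto simp: group_sources_def\<close>)
  have [measurable]: "(\<lambda>x. branching_process (L i j) (C i j) (fst x) (snd x))
      \<in> measurable (borel \<Otimes>\<^sub>M gen J) (count_space UNIV)" for j
    by (rule population_weight_measurable(4)[OF branching_tree_family])
       (use assms in \<open>auto simp: group_sources_def family_sources_def\<close>)
  show *: "(\<lambda>x. group_weight s i (fst x) (snd x)) \<in> borel_measurable (borel \<Otimes>\<^sub>M gen J)"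
    unfolding group_weight_def
    by (rule measurable_compose_countable[where g = "\<lambda>x. I i (snd x)"]) measurable
  show "group_weight s i u \<in> borel_measurable (gen J)"
    using measurable_compose[of "\<lambda>\<omega>. (u, \<omega>)" "gen J", OF _ *] by simp
qed

lemma group_weight_bounds:
  assumes "0 \<le> s" "s \<le> 1"
  shows "0 \<le> group_weight s i u \<omega>" "group_weight s i u \<omega> \<le> 1"
  using assms by (auto simp: group_weight_def power_le_one intro!: prod_nonneg prod_le_1)

text \<open>
  The p.g.f. of the group size is evaluated at the p.g.f. of a single family.
\<close>

lemma expectation_group_weight:
  assumes "0 \<le> s" "s < 1" "0 \<le> u"
  shows "expectation (group_weight s i u) = 1 - (1 - population_pgf A \<beta> s u) powr \<gamma>"
proof -
  have "expectation (group_weight s i u) =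
      expectation (\<lambda>\<omega>. \<Prod>j<I i \<omega>. expectation (\<lambda>\<omega>. s ^ branching_process (L i j) (C i j) u \<omega>))"
    unfolding group_weight_def
  proof (rule expectation_random_prod[OF _ _ group_size_measurable])
    show "disjoint_family (family_sources i)" "{Group_Size i} \<inter> family_sources i j = {}" for j
      by (auto simp: disjoint_family_on_def family_sources_def)
    have [measurable]: "branching_process (L i j) (C i j) u \<in> measurable (gen (family_sources i j)) (count_space UNIV)" for j
      by (rule population_weight_measurable(3)[OF branching_tree_family]) (simp add: family_sources_def)
    show "(\<lambda>\<omega>. s ^ branching_process (L i j) (C i j) u \<omega>) \<in> borel_measurable (gen (family_sources i j))" for j
      by measurable
  qed (use assms in \<open>auto simp: power_le_one\<close>)
  also have "\<dots> = pgf M (I i) (population_pgf A \<beta> s u)"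
    using expectation_power_branching_process[OF pos(1,3) A branching_tree_family assms] by (simp add: pgf_def)
  also have "\<dots> = 1 - (1 - population_pgf A \<beta> s u) powr \<gamma>"
    using population_pgf_bounds[of A \<beta> s u] A_pos pos assms by (intro group_size) auto
  finally show ?thesis .
qed

text \<open>
  Holding the flow fixed, the groups are independent and each is seen at its age \<open>t - \<tau>\<^sub>i\<close>.  What remains
  is an average of \<open>\<Prod>\<^sub>i \<phi>(t - \<tau>\<^sub>i)\<close> over the Poisson flow.
\<close>

theorem pgf_immigration_process:
  assumes s: "0 < s" "s < 1" and "0 < t"
  shows "pgf M (immigration_process N I L C t) s =
    exp (- \<theta> * integral {0..t} (\<lambda>u. (1 - population_pgf A \<beta> s u) powr \<gamma>))"
proof -
  define \<phi> where "\<phi> u = 1 - (1 - population_pgf A \<beta> s u) powr \<gamma>" for u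
  \<comment> \<open>ages must be nonnegative for all i, also for groups that have not arrived yet\<close>
  define T where "T i \<omega> = (if i < N t \<omega> then jump_time N i \<omega> else 0)" for i \<omega>
  define J where "J = (\<Union>i. group_sources i)"
  define f where "f x = (\<Prod>i<N t (fst x). group_weight s i (t - T i (fst x)) (snd x))" for x
  have disj: "{Flow} \<inter> J = {}"
    by (auto simp: J_def group_sources_def family_sources_def)
  have disj_groups: "disjoint_family_on group_sources S" for S
    by (auto simp: disjoint_family_on_def group_sources_def family_sources_def)
  have bounds: "0 \<le> group_weight s i u \<omega>" "group_weight s i u \<omega> \<le> 1" for i u \<omega>
    using group_weight_bounds[of s i u \<omega>] s by auto
  have T_bounds: "0 \<le> T i \<omega>" "T i \<omega> \<le> t" if "\<omega> \<in> space M" for i \<omega>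
  proof -
    have "N 0 \<omega> = 0" "mono_on {0..} (\<lambda>t. N t \<omega>)"
      using flow that by (auto simp: poisson_process_def)
    then show "0 \<le> T i \<omega>" "T i \<omega> \<le> t"
      using jump_time_bounds[of t 0 i N \<omega>] \<open>0 < t\<close> by (auto simp: T_def)
  qed
  have [measurable]: "T i \<in> borel_measurable (gen {Flow})" for i
    unfolding T_def using \<open>0 < t\<close> by (intro jump_time_measurable) simp
  have [measurable]: "N t \<in> measurable (gen {Flow}) (count_space UNIV)"
    using \<open>0 < t\<close> by (intro flow_measurable) simp
  have W: "(\<lambda>x. group_weight s i (fst x) (snd x)) \<in> borel_measurable (borel \<Otimes>\<^sub>M gen J)" for i
    by (rule group_weight_measurable) (auto simp: J_def)
  have [measurable]: "(\<lambda>x. group_weight s i (t - T i (fst x)) (snd x)) \<in> borel_measurable (gen {Flow} \<Otimes>\<^sub>M gen J)" for i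
    using measurable_compose[of "\<lambda>x. (t - T i (fst x), snd x)" "gen {Flow} \<Otimes>\<^sub>M gen J", OF _ W[of i]]
    by simp
  have f_meas: "f \<in> borel_measurable (gen {Flow} \<Otimes>\<^sub>M gen J)"
    unfolding f_def by (rule measurable_compose_countable[where g = "\<lambda>x. N t (fst x)"]) measurable
  have "pgf M (immigration_process N I L C t) s = expectation (\<lambda>\<omega>. f (\<omega>, \<omega>))"
    unfolding pgf_def immigration_process_def f_def group_weight_def T_def
    by (intro Bochner_Integration.integral_cong refl) (simp add: power_sum)
  also have "\<dots> = expectation (\<lambda>\<omega>. expectation (\<lambda>\<omega>'. f (\<omega>, \<omega>')))"
    using disj f_meas
    by (rule decouple(1)[where B = 1]) (use bounds in \<open>auto simp: f_def abs_prod intro!: prod_le_1\<close>)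
  also have "\<dots> = expectation (\<lambda>\<omega>. \<Prod>i<N t \<omega>. \<phi> (t - jump_time N i \<omega>))"
  proof (rule Bochner_Integration.integral_cong[OF refl])
    fix \<omega> assume \<omega>: "\<omega> \<in> space M"
    have "expectation (\<lambda>\<omega>'. f (\<omega>, \<omega>')) = (\<Prod>i<N t \<omega>. expectation (group_weight s i (t - T i \<omega>)))"
      unfolding f_def fst_conv snd_conv
      by (rule expectation_prod[OF disj_groups])
         (use bounds in \<open>auto intro!: group_weight_measurable(2)\<close>)
    also have "\<dots> = (\<Prod>i<N t \<omega>. \<phi> (t - jump_time N i \<omega>))"
    proof (rule prod.cong[OF refl])
      fix i assume "i \<in> {..<N t \<omega>}"
      then have "T i \<omega> = jump_time N i \<omega>" by (simp add: T_def)
      then show "expectation (group_weight s i (t - T i \<omega>)) = \<phi> (t - jump_time N i \<omega>)"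
        using T_bounds[OF \<omega>, of i] s by (simp add: \<phi>_def expectation_group_weight)
    qed
    finally show "expectation (\<lambda>\<omega>'. f (\<omega>, \<omega>')) = (\<Prod>i<N t \<omega>. \<phi> (t - jump_time N i \<omega>))" .
  qed
  also have "\<dots> = exp (- \<theta> * integral {0..t} (\<lambda>x. 1 - \<phi> (t - x)))"
  proof (rule expectation_prod_poisson_process[OF flow pos(2) \<open>0 < t\<close>])
    have "continuous_on {0..} \<phi>"
      unfolding \<phi>_def using A_pos pos s by (intro continuous_intros continuous_on_survival_powr) auto
    then show "continuous_on {0..t} (\<lambda>x. \<phi> (t - x))"
      by (rule continuous_on_compose2) (auto intro!: continuous_intros)
    show "\<phi> (t - x) \<in> {0..1}" if "x \<in> {0..t}" for x
    proof -
      have "population_pgf A \<beta> s (t - x) \<in> {0..1}"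
        using population_pgf_bounds[of A \<beta> s "t - x"] that A_pos pos s by auto
      then show ?thesis
        using pos powr_le1[of \<gamma> "1 - population_pgf A \<beta> s (t - x)"] by (auto simp: \<phi>_def)
    qed
  qed
  also have "integral {0..t} (\<lambda>x. 1 - \<phi> (t - x)) =
      integral {0..t} (\<lambda>u. (1 - population_pgf A \<beta> s u) powr \<gamma>)"
    using integral_reflect_Icc[OF continuous_on_subset[OF continuous_on_survival_powr[of A \<beta> s \<gamma>]], of t]
      A_pos pos s \<open>0 < t\<close> by (simp add: \<phi>_def)
  finally show ?thesis .
qed

end


section \<open>Asymptotics of the exponent\<close>

text \<open>
  If every particle living at time \<open>t\<close> is marked with probability \<open>1 - s\<close>, then \<open>\<theta>\<close> times this integral
  is the mean number of groups with a marked descendant.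
\<close>

definition survival_integral :: "real \<Rightarrow> real \<Rightarrow> real \<Rightarrow> real \<Rightarrow> real \<Rightarrow> real" where
  "survival_integral A \<beta> \<gamma> s t = integral {0..t} (\<lambda>u. (1 - population_pgf A \<beta> s u) powr \<gamma>)"

context
  fixes A \<beta> \<gamma> s t :: real
  assumes pos: "0 < A" "0 < \<beta>" "0 < \<gamma>" and s: "0 < s" "s < 1" and t: "0 \<le> t"
begin

lemma survival_powr:
  assumes "0 \<le> u"
  shows "(1 - population_pgf A \<beta> s u) powr \<gamma> =
    (1 - s) powr \<gamma> * (1 + (1 - s) powr \<beta> / A * u) powr (- \<gamma> / \<beta>)"
  using assms pos s by (simp add: population_pgf_def powr_mult powr_powr)

lemma survival_integrable:
  "(\<lambda>u. (1 - population_pgf A \<beta> s u) powr \<gamma>) integrable_on {0..t}"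
  using pos s
  by (intro integrable_continuous_interval continuous_on_subset[OF continuous_on_survival_powr]) auto

lemma survival_integral_le: "survival_integral A \<beta> \<gamma> s t \<le> t * (1 - s) powr \<gamma>"
proof -
  have "survival_integral A \<beta> \<gamma> s t \<le> integral {0..t} (\<lambda>u. (1 - s) powr \<gamma>)"
    unfolding survival_integral_def
    using pos s population_pgf_bounds[of A \<beta> s]
    by (intro integral_le survival_integrable powr_mono2) auto
  then show ?thesis using t by simp
qed

lemma survival_integral_ge:
  "t * (1 - s) powr \<gamma> * (1 + (1 - s) powr \<beta> * t / A) powr (- \<gamma> / \<beta>) \<le> survival_integral A \<beta> \<gamma> s t"
proof -
  let ?m = "(1 - s) powr \<gamma> * (1 + (1 - s) powr \<beta> / A * t) powr (- \<gamma> / \<beta>)"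
  have "integral {0..t} (\<lambda>u. ?m) \<le> survival_integral A \<beta> \<gamma> s t"
    unfolding survival_integral_def
  proof (intro integral_le survival_integrable)
    fix u assume u: "u \<in> {0..t}"
    have "(1 - s) powr \<beta> / A * u \<le> (1 - s) powr \<beta> / A * t"
      using u pos by (intro mult_left_mono) auto
    then have "(1 + (1 - s) powr \<beta> / A * t) powr (- \<gamma> / \<beta>) \<le> (1 + (1 - s) powr \<beta> / A * u) powr (- \<gamma> / \<beta>)"
      using u pos by (intro powr_mono2') (auto intro!: add_pos_nonneg)
    then show "?m \<le> (1 - population_pgf A \<beta> s u) powr \<gamma>"
      using u survival_powr[of u] by (simp add: mult_left_mono)
  qed (rule integrable_const_ivl)
  then show ?thesis using t by (simp add: mult_ac)
qed

lemma survival_integral_eq_ln: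
  assumes "\<gamma> = \<beta>"
  shows "survival_integral A \<beta> \<gamma> s t = A * ln (1 + (1 - s) powr \<beta> * t / A)"
proof -
  let ?c = "(1 - s) powr \<beta> / A"
  have c: "0 < ?c" using pos s by simp
  have "((\<lambda>u. (1 - population_pgf A \<beta> s u) powr \<gamma>) has_integral
      A * ln (1 + ?c * t) - A * ln (1 + ?c * 0)) {0..t}"
  proof (rule fundamental_theorem_of_calculus[OF t])
    fix u assume u: "u \<in> {0..t}"
    then have D: "0 < 1 + ?c * u"
      using c by (intro add_pos_nonneg mult_nonneg_nonneg) auto
    have "((\<lambda>u. A * ln (1 + ?c * u)) has_real_derivative A * (?c / (1 + ?c * u))) (at u)"
      using D by (auto intro!: derivative_eq_intros)
    moreover have "A * (?c / (1 + ?c * u)) = (1 - population_pgf A \<beta> s u) powr \<gamma>"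
      using survival_powr[of u] u pos assms D by (simp add: powr_minus divide_inverse)
    ultimately show "((\<lambda>u. A * ln (1 + ?c * u)) has_vector_derivative
        (1 - population_pgf A \<beta> s u) powr \<gamma>) (at u within {0..t})"
      by (simp add: has_real_derivative_iff_has_vector_derivative[symmetric] has_field_derivative_at_within)
  qed
  then show ?thesis
    by (simp add: survival_integral_def integral_unique)
qed

text \<open>
  For \<open>\<gamma> > \<beta>\<close> the exponent \<open>- \<gamma> / \<beta>\<close> of the integrand is below \<open>-1\<close>, so the integral over the whole
  half-line converges and bounds the integral up to any \<open>t\<close>.
\<close>

lemma survival_integral_le_const:
  assumes "\<beta> < \<gamma>"
  shows "survival_integral A \<beta> \<gamma> s t \<le> A * \<beta> / (\<gamma> - \<beta>) * (1 - s) powr (\<gamma> - \<beta>)"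
proof -
  let ?c = "(1 - s) powr \<beta> / A" and ?p = "\<gamma> / \<beta> - 1"
  have c: "0 < ?c" and p: "0 < ?p" using pos s assms by auto
  define G where "G u = - ((1 - s) powr \<gamma> / (?c * ?p) * (1 + ?c * u) powr (- ?p))" for u
  have "((\<lambda>u. (1 - population_pgf A \<beta> s u) powr \<gamma>) has_integral G t - G 0) {0..t}"
  proof (rule fundamental_theorem_of_calculus[OF t])
    fix u assume u: "u \<in> {0..t}"
    then have D: "0 < 1 + ?c * u"
      using c by (intro add_pos_nonneg mult_nonneg_nonneg) auto
    have "((\<lambda>u. (1 + ?c * u) powr (- ?p)) has_real_derivative
        - ?p * (1 + ?c * u) powr (- ?p - 1) * ?c) (at u)"
      using D pos by (auto intro!: derivative_eq_intros)
    from DERIV_minus[OF DERIV_cmult[OF this, of "(1 - s) powr \<gamma> / (?c * ?p)"]]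
    have "(G has_real_derivative
        - ((1 - s) powr \<gamma> / (?c * ?p) * (- ?p * (1 + ?c * u) powr (- ?p - 1) * ?c))) (at u)"
      unfolding G_def[abs_def] .
    moreover have "- (y / (c * p) * (- p * w * c)) = y * w" if "0 < c" "0 < p" for y c p w :: real
      using that by (simp add: field_simps)
    ultimately have "(G has_real_derivative (1 - s) powr \<gamma> * (1 + ?c * u) powr (- ?p - 1)) (at u)"
      using c p by metis
    moreover have "- ?p - 1 = - \<gamma> / \<beta>" by simp
    ultimately show "(G has_vector_derivative (1 - population_pgf A \<beta> s u) powr \<gamma>) (at u within {0..t})"
      using survival_powr[of u] u
      by (simp add: has_real_derivative_iff_has_vector_derivative[symmetric] has_field_derivative_at_within)
  qed
  then have "survival_integral A \<beta> \<gamma> s t = G t - G 0"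
    by (simp add: survival_integral_def integral_unique)
  also have "\<dots> \<le> - G 0"
  proof -
    have "0 \<le> (1 - s) powr \<gamma> / (?c * ?p) * (1 + ?c * t) powr (- ?p)"
      using c p by (intro mult_nonneg_nonneg divide_nonneg_pos mult_pos_pos powr_ge_zero)
    then show ?thesis by (simp only: G_def)
  qed
  also have "\<dots> = A * \<beta> / (\<gamma> - \<beta>) * (1 - s) powr (\<gamma> - \<beta>)"
    using pos s assms by (simp add: G_def powr_diff field_simps)
  finally show ?thesis .
qed

lemma survival_integral_nonneg: "0 \<le> survival_integral A \<beta> \<gamma> s t"
  unfolding survival_integral_def by (intro integral_nonneg survival_integrable) auto

end

text \<open>
  Since \<open>1 - e^(-y) \<sim> y\<close> as \<open>y\<close> tends to 0, the normalisation \<open>t / A = z^(-b)\<close> turns \<open>x\<^sup>b t / A\<close> into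
  \<open>(x / z)\<^sup>b\<close>, and \<open>x / z\<close> tends to \<open>lam\<close>.
\<close>

lemma normalisation_limits:
  fixes z :: "real \<Rightarrow> real"
  assumes "0 < A" "0 < b" "0 < lam"
    and z_pos: "\<forall>t>0. z t > 0"
    and z: "\<forall>t>0. t / A = z t powr (- b)"
  defines "x \<equiv> \<lambda>t. 1 - exp (- lam * z t)"
  shows "(x \<longlongrightarrow> 0) at_top"
    and "((\<lambda>t. x t powr b * t / A) \<longlongrightarrow> lam powr b) at_top"
    and "eventually (\<lambda>t. 0 < x t \<and> x t < 1 \<and> 0 < t) at_top"
proof -
  have ev: "eventually (\<lambda>t::real. 0 < t) at_top"
    by (rule eventually_gt_at_top)
  have z_eq: "z t = (t / A) powr (- 1 / b)" if "0 < t" for t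
    using z z_pos[rule_format, OF that] that \<open>0 < b\<close> by (simp add: powr_powr)
  have "((\<lambda>t. (t / A) powr (- 1 / b)) \<longlongrightarrow> 0) at_top"
    using assms unfolding divide_inverse[of _ A]
    by (intro tendsto_neg_powr filterlim_at_top_mult_tendsto_pos[OF tendsto_const] filterlim_ident) auto
  moreover have "eventually (\<lambda>t. (t / A) powr (- 1 / b) = z t) at_top"
    using ev by eventually_elim (simp add: z_eq)
  ultimately have z_0: "(z \<longlongrightarrow> 0) at_top"
    by (rule Lim_transform_eventually)
  show "(x \<longlongrightarrow> 0) at_top"
    unfolding x_def by (rule tendsto_eq_intros z_0 refl | simp)+
  show "eventually (\<lambda>t. 0 < x t \<and> x t < 1 \<and> 0 < t) at_top"
    using ev by eventually_elim (use z_pos \<open>0 < lam\<close> in \<open>auto simp: x_def\<close>)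
  have "((\<lambda>y. (1 - exp (- lam * y)) / y) \<longlongrightarrow> lam) (at 0)"
  proof -
    have "((\<lambda>y. 1 - exp (- lam * y)) has_real_derivative lam) (at 0)"
      by (auto intro!: derivative_eq_intros)
    then show ?thesis by (simp add: has_field_derivative_iff)
  qed
  moreover have "filterlim z (at 0) at_top"
    using z_0 eventually_mono[OF ev, of "\<lambda>t. z t \<noteq> 0"] z_pos by (force simp: filterlim_at)
  ultimately have "((\<lambda>t. x t / z t) \<longlongrightarrow> lam) at_top"
    unfolding x_def by (rule filterlim_compose)
  then have "((\<lambda>t. (x t / z t) powr b) \<longlongrightarrow> lam powr b) at_top"
    using \<open>0 < lam\<close> by (intro tendsto_intros) auto
  moreover have "eventually (\<lambda>t. (x t / z t) powr b = x t powr b * t / A) at_top"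
    using ev
  proof eventually_elim
    case (elim t)
    then have "(x t / z t) powr b = x t powr b * z t powr (- b)"
      using elim z_pos \<open>0 < lam\<close> by (simp add: x_def powr_divide powr_minus_divide)
    also have "\<dots> = x t powr b * t / A"
      using z elim by (metis times_divide_eq_right)
    finally show ?case .
  qed
  ultimately show "((\<lambda>t. x t powr b * t / A) \<longlongrightarrow> lam powr b) at_top"
    by (rule Lim_transform_eventually)
qed

text \<open>
  For \<open>\<gamma> < \<beta>\<close> the two-sided bound decides: under \<open>b = \<gamma>\<close> the damping factor
  \<open>(1 + x\<^sup>\<beta> t / A)^(-\<gamma>/\<beta>)\<close> tends to 1, so that both bounds have the same limit; under \<open>b = \<beta>\<close> it keeps a positive
  limit while \<open>t x\<^sup>\<gamma>\<close> diverges.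
\<close>

lemma survival_integral_limits:
  fixes z :: "real \<Rightarrow> real"
  assumes pos: "0 < A" "0 < \<beta>" "0 < \<gamma>" "0 < lam" "0 < b"
    and z_pos: "\<forall>t>0. z t > 0"
    and z: "\<forall>t>0. t / A = z t powr (- b)"
  defines "J \<equiv> \<lambda>t. survival_integral A \<beta> \<gamma> (exp (- lam * z t)) t"
  shows "\<gamma> = \<beta> \<Longrightarrow> b = \<beta> \<Longrightarrow> (J \<longlongrightarrow> A * ln (1 + lam powr \<beta>)) at_top"
    and "\<gamma> < \<beta> \<Longrightarrow> b = \<gamma> \<Longrightarrow> (J \<longlongrightarrow> A * lam powr \<gamma>) at_top"
    and "\<gamma> < \<beta> \<Longrightarrow> b = \<beta> \<Longrightarrow> filterlim J at_top at_top"
    and "\<beta> < \<gamma> \<Longrightarrow> (J \<longlongrightarrow> 0) at_top"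
proof -
  define x where "x t = 1 - exp (- lam * z t)" for t
  note lim = normalisation_limits[OF pos(1,5,4) z_pos z, folded x_def]
  have x_0: "filterlim x (at_right 0) at_top"
    using lim(1,3) by (auto simp: filterlim_at elim: eventually_mono)
  have scaled: "((\<lambda>t. t * x t powr b) \<longlongrightarrow> A * lam powr b) at_top"
    using tendsto_mult_left[OF lim(2), of A] pos by (simp add: mult.commute)
  have powr_0: "((\<lambda>t. x t powr d) \<longlongrightarrow> 0) at_top" if "0 < d" for d
    using lim(1,3) that by (intro tendsto_zero_powrI[OF _ tendsto_const]) (auto elim!: eventually_mono)
  have damping: "((\<lambda>t. (1 + x t powr \<beta> * t / A) powr (- \<gamma> / \<beta>)) \<longlongrightarrow> (1 + l) powr (- \<gamma> / \<beta>)) at_top"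
    if "((\<lambda>t. x t powr \<beta> * t / A) \<longlongrightarrow> l) at_top" "0 \<le> l" for l
    using that by (intro tendsto_powr tendsto_add tendsto_const) auto
  have bounds: "eventually (\<lambda>t. t * x t powr \<gamma> * (1 + x t powr \<beta> * t / A) powr (- \<gamma> / \<beta>) \<le> J t \<and>
      J t \<le> t * x t powr \<gamma>) at_top"
    using lim(3)
    by eventually_elim
      (use survival_integral_ge[OF pos(1-3)] survival_integral_le[OF pos(1-3)] in \<open>auto simp: J_def x_def\<close>)
  show "(J \<longlongrightarrow> A * ln (1 + lam powr \<beta>)) at_top" if "\<gamma> = \<beta>" "b = \<beta>"
  proof -
    have "((\<lambda>t. A * ln (1 + x t powr \<beta> * t / A)) \<longlongrightarrow> A * ln (1 + lam powr \<beta>)) at_top"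
      using lim(2) that by (intro tendsto_intros) (auto simp: add_pos_nonneg less_imp_neq[THEN not_sym])
    moreover have "eventually (\<lambda>t. A * ln (1 + x t powr \<beta> * t / A) = J t) at_top"
      using lim(3)
      by eventually_elim (use survival_integral_eq_ln[OF pos(1-3) _ _ _ that(1)] in \<open>auto simp: J_def x_def\<close>)
    ultimately show ?thesis by (rule Lim_transform_eventually)
  qed
  show "(J \<longlongrightarrow> A * lam powr \<gamma>) at_top" if "\<gamma> < \<beta>" "b = \<gamma>"
  proof (rule tendsto_sandwich)
    have "((\<lambda>t. x t powr (\<beta> - \<gamma>) * (x t powr b * t / A)) \<longlongrightarrow> 0 * lam powr b) at_top"
      using that by (intro tendsto_mult powr_0 lim(2)) auto
    moreover have "eventually (\<lambda>t. x t powr (\<beta> - \<gamma>) * (x t powr b * t / A) = x t powr \<beta> * t / A) at_top"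
      using lim(3) by eventually_elim (use that in \<open>auto simp: powr_diff\<close>)
    ultimately have "((\<lambda>t. x t powr \<beta> * t / A) \<longlongrightarrow> 0 * lam powr b) at_top"
      by (rule Lim_transform_eventually)
    then have "((\<lambda>t. t * x t powr \<gamma> * (1 + x t powr \<beta> * t / A) powr (- \<gamma> / \<beta>)) \<longlongrightarrow>
        A * lam powr \<gamma> * (1 + 0 * lam powr b) powr (- \<gamma> / \<beta>)) at_top"
      using scaled that by (intro tendsto_mult[OF _ damping]) auto
    then show "((\<lambda>t. t * x t powr \<gamma> * (1 + x t powr \<beta> * t / A) powr (- \<gamma> / \<beta>)) \<longlongrightarrow>
        A * lam powr \<gamma>) at_top"
      by simp
    show "((\<lambda>t. t * x t powr \<gamma>) \<longlongrightarrow> A * lam powr \<gamma>) at_top"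
      using scaled that by simp
  qed (use bounds in \<open>auto elim: eventually_mono\<close>)
  show "filterlim J at_top at_top" if "\<gamma> < \<beta>" "b = \<beta>"
  proof (rule filterlim_at_top_mono)
    \<comment> \<open>write t x^\<gamma> = (t x^\<beta>) x^(\<gamma> - \<beta>), where the first factor has a positive limit\<close>
    have "filterlim (\<lambda>t. x t powr (\<gamma> - \<beta>)) at_top at_top"
    proof -
      have "filterlim (\<lambda>t. inverse (x t powr (\<beta> - \<gamma>))) at_top at_top"
        using powr_0[of "\<beta> - \<gamma>"] lim(3) that
        by (intro filterlim_inverse_at_top) (auto elim!: eventually_mono)
      then show ?thesis by (simp add: powr_minus[symmetric])
    qed
    moreover have "((\<lambda>t. t * x t powr b * (1 + x t powr \<beta> * t / A) powr (- \<gamma> / \<beta>)) \<longlongrightarrow>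
        A * lam powr b * (1 + lam powr b) powr (- \<gamma> / \<beta>)) at_top"
      using lim(2) scaled that by (intro tendsto_mult[OF _ damping]) auto
    ultimately have "filterlim (\<lambda>t. t * x t powr b * (1 + x t powr \<beta> * t / A) powr (- \<gamma> / \<beta>) *
        x t powr (\<gamma> - \<beta>)) at_top at_top"
      using pos add_pos_nonneg[OF zero_less_one powr_ge_zero[of lam b]]
      by (intro filterlim_tendsto_pos_mult_at_top[where c = "A * lam powr b * (1 + lam powr b) powr (- \<gamma> / \<beta>)"])
         auto
    moreover have "eventually (\<lambda>t. t * x t powr b * (1 + x t powr \<beta> * t / A) powr (- \<gamma> / \<beta>) *
        x t powr (\<gamma> - \<beta>) = t * x t powr \<gamma> * (1 + x t powr \<beta> * t / A) powr (- \<gamma> / \<beta>)) at_top"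
      using lim(3) by eventually_elim (use that in \<open>auto simp: powr_diff\<close>)
    ultimately show "filterlim (\<lambda>t. t * x t powr \<gamma> * (1 + x t powr \<beta> * t / A) powr (- \<gamma> / \<beta>)) at_top at_top"
      by (simp only: filterlim_cong[OF refl refl])
  qed (use bounds in \<open>auto elim: eventually_mono\<close>)
  show "(J \<longlongrightarrow> 0) at_top" if "\<beta> < \<gamma>"
  proof (rule tendsto_sandwich)
    show "eventually (\<lambda>t. 0 \<le> J t) at_top"
      using lim(3)
      by eventually_elim (use survival_integral_nonneg[OF pos(1-3)] in \<open>auto simp: J_def x_def\<close>)
    show "eventually (\<lambda>t. J t \<le> A * \<beta> / (\<gamma> - \<beta>) * x t powr (\<gamma> - \<beta>)) at_top"
      using lim(3)
      by eventually_elim (use survival_integral_le_const[OF pos(1-3) _ _ _ that] in \<open>auto simp: J_def x_def\<close>)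
    have "((\<lambda>t. A * \<beta> / (\<gamma> - \<beta>) * x t powr (\<gamma> - \<beta>)) \<longlongrightarrow> A * \<beta> / (\<gamma> - \<beta>) * 0) at_top"
      using that by (intro tendsto_mult tendsto_const powr_0) auto
    then show "((\<lambda>t. A * \<beta> / (\<gamma> - \<beta>) * x t powr (\<gamma> - \<beta>)) \<longlongrightarrow> 0) at_top"
      by simp
  qed simp
qed


section \<open>The limit theorem\<close>

theorem theorem2:
  fixes M :: "'a measure"
    and K \<theta> \<beta> \<gamma> A :: real
    and N :: "real \<Rightarrow> 'a \<Rightarrow> nat"
    and I :: "nat \<Rightarrow> 'a \<Rightarrow> nat"
    and L :: "nat \<Rightarrow> nat \<Rightarrow> nat list \<Rightarrow> 'a \<Rightarrow> real"
    and C :: "nat \<Rightarrow> nat \<Rightarrow> nat list \<Rightarrow> 'a \<Rightarrow> nat"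
    and Y :: "real \<Rightarrow> 'a \<Rightarrow> nat"
    and z :: "real \<Rightarrow> real"
    and \<Psi> :: "real \<Rightarrow> real \<Rightarrow> real"
  assumes "prob_space M"
    and "K > 0" and "\<theta> > 0" and "0 < \<beta>" and "\<beta> \<le> 1" and "0 < \<gamma>" and "\<gamma> \<le> 1"
    and "A = (1 + \<beta>) / (K * \<beta>)"
    and flow: "poisson_process M \<theta> N"
    and group_size: "\<And>i. I i \<in> measurable M (count_space UNIV)"
      "\<And>i s. \<bar>s\<bar> \<le> 1 \<Longrightarrow> pgf M (I i) s = 1 - (1 - s) powr \<gamma>"
    and life_time: "\<And>i j u. distributed M lborel (L i j u) (exponential_density K)"
    and offspring: "\<And>i j u. C i j u \<in> measurable M (count_space UNIV)"
      "\<And>i j u s. \<bar>s\<bar> \<le> 1 \<Longrightarrow> pgf M (C i j u) s = s + (1 - s) powr (1 + \<beta>) / (1 + \<beta>)"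
    and independent: "prob_space.indep_sets M (source_events M N I L C) UNIV"
    and Y: "Y = immigration_process N I L C"
    and z_pos: "\<And>t. t > 0 \<Longrightarrow> z t > 0"
    and \<Psi>: "\<Psi> = normalised_laplace M Y z"
  shows "(\<gamma> = \<beta> \<and> (\<forall>t>0. t / A = z t powr (- \<beta>)) \<longrightarrow>
            (\<forall>lam>0. ((\<lambda>t. \<Psi> t lam) \<longlongrightarrow> (1 / (1 + lam powr \<beta>)) powr (\<theta> * A)) at_top)) \<and>
         (\<gamma> < \<beta> \<and> (\<forall>t>0. t / A = z t powr (- \<gamma>)) \<longrightarrow>
            (\<forall>lam>0. ((\<lambda>t. \<Psi> t lam) \<longlongrightarrow> exp (- \<theta> * A * lam powr \<gamma>)) at_top)) \<and>
         (\<gamma> < \<beta> \<and> (\<forall>t>0. t / A = z t powr (- \<beta>)) \<longrightarrow>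
            (\<forall>lam>0. ((\<lambda>t. \<Psi> t lam) \<longlongrightarrow> 0) at_top)) \<and>
         (\<beta> < \<gamma> \<and> (\<forall>t>0. t / A = z t powr (- \<beta>)) \<longrightarrow>
            (\<forall>lam>0. ((\<lambda>t. \<Psi> t lam) \<longlongrightarrow> 1) at_top)) \<and>
         (\<beta> < \<gamma> \<and> (\<forall>t>0. t / A = z t powr (- \<gamma>)) \<longrightarrow>
            (\<forall>lam>0. ((\<lambda>t. \<Psi> t lam) \<longlongrightarrow> 1) at_top))"
proof -
  interpret prob_space M by fact
  interpret branching_immigration M K \<theta> \<beta> \<gamma> A N I L C
    by unfold_locales (fact assms)+
  define J where "J lam t = survival_integral A \<beta> \<gamma> (exp (- lam * z t)) t" for lam t
  have \<Psi>_eq: "\<Psi> t lam = exp (- \<theta> * J lam t)" if "0 < t" "0 < lam" for t lam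
  proof -
    have "exp (- lam * (z t * real n)) = exp (- lam * z t) ^ n" for n
      by (simp add: exp_of_nat_mult[symmetric] algebra_simps)
    then have "\<Psi> t lam = pgf M (immigration_process N I L C t) (exp (- lam * z t))"
      by (simp add: \<Psi> Y normalised_laplace_def pgf_def)
    also have "\<dots> = exp (- \<theta> * J lam t)"
      unfolding J_def survival_integral_def
      by (rule pgf_immigration_process) (use that z_pos in auto)
    finally show ?thesis .
  qed
  have z_pos': "\<forall>t>0. z t > 0"
    using z_pos by blast
  note J_limits = survival_integral_limits[OF A_pos \<open>0 < \<beta>\<close> \<open>0 < \<gamma>\<close> _ _ z_pos', folded J_def]
  have \<Psi>_lim: "((\<lambda>t. \<Psi> t lam) \<longlongrightarrow> l) at_top"
    if "0 < lam" "((\<lambda>t. exp (- \<theta> * J lam t)) \<longlongrightarrow> l) at_top" for lam l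
  proof (rule Lim_transform_eventually[OF that(2)])
    show "eventually (\<lambda>t. exp (- \<theta> * J lam t) = \<Psi> t lam) at_top"
      using eventually_gt_at_top[of 0] by eventually_elim (simp add: \<Psi>_eq that(1))
  qed
  show ?thesis
  proof (intro conjI impI allI; elim conjE)
    fix lam :: real
    assume "\<gamma> = \<beta>" and z: "\<forall>t>0. t / A = z t powr (- \<beta>)" and lam: "0 < lam"
    have "((\<lambda>t. exp (- \<theta> * J lam t)) \<longlongrightarrow> exp (- \<theta> * (A * ln (1 + lam powr \<beta>)))) at_top"
      using J_limits(1)[OF lam \<open>0 < \<beta>\<close> z \<open>\<gamma> = \<beta>\<close> refl] by (intro tendsto_intros)
    moreover have "exp (- \<theta> * (A * ln (1 + lam powr \<beta>))) = (1 / (1 + lam powr \<beta>)) powr (\<theta> * A)"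
      using add_pos_nonneg[OF zero_less_one powr_ge_zero[of lam \<beta>]]
      by (simp add: powr_def ln_div)
    ultimately show "((\<lambda>t. \<Psi> t lam) \<longlongrightarrow> (1 / (1 + lam powr \<beta>)) powr (\<theta> * A)) at_top"
      using \<Psi>_lim[OF lam] by simp
  next
    fix lam :: real
    assume "\<gamma> < \<beta>" and z: "\<forall>t>0. t / A = z t powr (- \<gamma>)" and lam: "0 < lam"
    have "((\<lambda>t. exp (- \<theta> * J lam t)) \<longlongrightarrow> exp (- \<theta> * (A * lam powr \<gamma>))) at_top"
      using J_limits(2)[OF lam \<open>0 < \<gamma>\<close> z \<open>\<gamma> < \<beta>\<close> refl] by (intro tendsto_intros)
    then show "((\<lambda>t. \<Psi> t lam) \<longlongrightarrow> exp (- \<theta> * A * lam powr \<gamma>)) at_top"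
      using \<Psi>_lim[OF lam] by (simp add: mult.assoc)
  next
    fix lam :: real
    assume "\<gamma> < \<beta>" and z: "\<forall>t>0. t / A = z t powr (- \<beta>)" and lam: "0 < lam"
    have "filterlim (J lam) at_top at_top"
      using J_limits(3)[OF lam \<open>0 < \<beta>\<close> z \<open>\<gamma> < \<beta>\<close> refl] .
    then have "filterlim (\<lambda>t. - (\<theta> * J lam t)) at_bot at_top"
      using \<open>\<theta> > 0\<close> by (simp add: filterlim_uminus_at_top[symmetric] filterlim_tendsto_pos_mult_at_top[OF tendsto_const])
    then have "((\<lambda>t. exp (- \<theta> * J lam t)) \<longlongrightarrow> 0) at_top"
      by (simp add: filterlim_compose[OF exp_at_bot])
    then show "((\<lambda>t. \<Psi> t lam) \<longlongrightarrow> 0) at_top"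
      by (rule \<Psi>_lim[OF lam])
  next
    fix lam :: real
    assume "\<beta> < \<gamma>" and z: "\<forall>t>0. t / A = z t powr (- \<beta>)" and lam: "0 < lam"
    have "((\<lambda>t. exp (- \<theta> * J lam t)) \<longlongrightarrow> exp (- \<theta> * 0)) at_top"
      using J_limits(4)[OF lam \<open>0 < \<beta>\<close> z \<open>\<beta> < \<gamma>\<close>] by (intro tendsto_intros)
    then show "((\<lambda>t. \<Psi> t lam) \<longlongrightarrow> 1) at_top"
      using \<Psi>_lim[OF lam] by simp
  next
    fix lam :: real
    assume "\<beta> < \<gamma>" and z: "\<forall>t>0. t / A = z t powr (- \<gamma>)" and lam: "0 < lam"
    have "((\<lambda>t. exp (- \<theta> * J lam t)) \<longlongrightarrow> exp (- \<theta> * 0)) at_top"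
      using J_limits(4)[OF lam \<open>0 < \<gamma>\<close> z \<open>\<beta> < \<gamma>\<close>] by (intro tendsto_intros)
    then show "((\<lambda>t. \<Psi> t lam) \<longlongrightarrow> 1) at_top"
      using \<Psi>_lim[OF lam] by simp
  qed
qed

end
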